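(* Let $\mathsf R,\mathsf E$ be totally ordered finite sets with $|\mathsf R|=d\le n=|\mathsf E|$, let $\mathcal T$ be a triangulation of $\triangle_{d-1}\times\triangle_{n-1}$, and let $A\in\{-1,1\}^{\mathsf R\times\mathsf E}$. Let $\widetilde{\mathsf R}$ be a copy of $\mathsf R$, $\widetilde{\mathsf E}=\widetilde{\mathsf R}\cup\mathsf E$, $\widetilde A=(I_{d,d}\mid A)$, and let $\widetilde{\mathcal M}$ be the oriented matroid on $\widetilde{\mathsf E}$ induced by the pointed polyhedral matching field of $\mathcal T$ and the sign matrix $\widetilde A$. Let $F$ be a subgraph of a tree in $\widetilde{\mathcal T}$ without isolated nodes in $\mathsf E\subset\widetilde{\mathsf E}$ and such that a node in $\widetilde{\mathsf R}\subset\widetilde{\mathsf E}$ is isolated only if the corresponding node in $\mathsf R$ is isolated as well. Let $S\in\{-1,0,1\}^{\mathsf R}$ be a sign vector whose support contains the set of non-isolated nodes of $F$ in $\mathsf R$. Then the sign vector $\psi_{\widetilde A}(S,F)$ is a covector of $\widetilde{\mathcal M}$.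
   Context: **Trees.** A triangulation of $\triangle_{d-1}\times\triangle_{n-1}$ (with $\triangle_{k-1}=\operatorname{conv}\{\mathbf e_1,\dots,\mathbf e_k\}$) is a collection of full-dimensional simplices with vertices among the $(\mathbf e_i,\mathbf e_j)$, with union $\triangle_{d-1}\times\triangle_{n-1}$, any two intersecting in a common face. Identifying $(\mathbf e_i,\mathbf e_j)$ with the edge $(i,j)$ of $K_{\mathsf R,\mathsf E}$, each simplex becomes a spanning tree of $K_{\mathsf R,\mathsf E}$. $\widetilde{\mathcal T}$ is the set of trees on $\mathsf R\sqcup\widetilde{\mathsf E}$ obtained from the trees of $\mathcal T$ by adding the nodes $\widetilde{\mathsf R}$ and an edge between each node of $\mathsf R$ and its copy in $\widetilde{\mathsf R}$. In $\widetilde{\mathsf E}$ all elements of $\widetilde{\mathsf R}$ (ordered as $\mathsf R$) precede all elements of $\mathsf E$. Subgraphs are given by edge sets on the full node set; a node is isolated if it is incident to no edge. **The oriented matroid.** The pointed polyhedral matching field of $\mathcal T$ consists, for each $d$-subset $\sigma\subseteq\widetilde{\mathsf E}$, of the unique perfect matching $M_\sigma$ between $\mathsf R$ and $\sigma$ contained in some tree of $\widetilde{\mathcal T}$. $\widetilde{\mathcal M}$ is the oriented matroid with chirotope $\sigma\mapsto\operatorname{sign}(M_\sigma)\prod_{e\in M_\sigma}\widetilde A_e$ (known to be a chirotope), where $\operatorname{sign}(M_\sigma)$ is the sign of the permutation $[d]\to\mathsf R\to\sigma\to[d]$ (order-preserving bijections at both ends, $M_\sigma$ in the middle). **The map $\psi$.**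 For a sign matrix $A$ with rows $\mathsf R$ and columns $E'$, $S\in\{-1,0,1\}^{\mathsf R}$ and $F\subseteq\mathsf R\times E'$, let $SA_F$ be the matrix with $(SA_F)_{i,j}=S_iA_{i,j}$ if $(i,j)\in F$ and $0$ otherwise. Then $\psi_A(S,F)=Z\in\{-1,0,1\}^{E'}$, where $Z_j=0$ if column $j$ of $SA_F$ has both positive and negative entries or is all zero, $Z_j=1$ if column $j$ is non-zero with only non-negative entries, and $Z_j=-1$ if column $j$ is non-zero with only non-positive entries. Covectors are in the standard sense of oriented matroid theory (compositions of signed cocircuits, and the zero vector). *)

theory Defs
  imports "HOL-Analysis.Analysis"
begin

text \<open>
  The sets \<open>R\<close> and \<open>E\<close> are finite linearly ordered types \<open>'r\<close> and \<open>'e\<close>. The extended ground set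
  is the sum type \<open>'r + 'e\<close>, where \<open>Inl i\<close> is the copy of the row node \<open>i\<close>. Bipartite graphs
  between rows and columns are edge sets \<open>('r \<times> 'c) set\<close>; the node set is always the full one.
\<close>

instantiation sum :: (linorder, linorder) linorder
begin

fun less_eq_sum :: "'a + 'b \<Rightarrow> 'a + 'b \<Rightarrow> bool" where
  "less_eq_sum (Inl a) (Inl a') \<longleftrightarrow> a \<le> a'"
| "less_eq_sum (Inl a) (Inr b) \<longleftrightarrow> True"
| "less_eq_sum (Inr b) (Inl a) \<longleftrightarrow> False"
| "less_eq_sum (Inr b) (Inr b') \<longleftrightarrow> b \<le> b'"

definition less_sum :: "'a + 'b \<Rightarrow> 'a + 'b \<Rightarrow> bool" where
  "less_sum x y \<longleftrightarrow> x \<le> y \<and> \<not> y \<le> x"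

instance
proof
  fix x y z :: "'a + 'b"
  show "x < y \<longleftrightarrow> x \<le> y \<and> \<not> y \<le> x" by (simp add: less_sum_def)
  show "x \<le> x" by (cases x) auto
  show "x \<le> y \<Longrightarrow> y \<le> z \<Longrightarrow> x \<le> z" by (cases x; cases y; cases z) auto
  show "x \<le> y \<Longrightarrow> y \<le> x \<Longrightarrow> x = y" by (cases x; cases y) auto
  show "x \<le> y \<or> y \<le> x" by (cases x; cases y) auto
qed

end


section \<open>Triangulations of products of simplices and their trees\<close>

definition std_simplex :: "(real ^ 'k) set" where
  "std_simplex = convex hull (range (\<lambda>i. axis i 1))"

definition prod_vertex :: "'r \<Rightarrow> 'e \<Rightarrow> (real ^ 'r) \<times> (real ^ 'e)" where
  "prod_vertex i j = (axis i 1, axis j 1)"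

definition prod_triangulation ::
  "((real ^ 'r::finite) \<times> (real ^ 'e::finite)) set set \<Rightarrow> bool" where
  "prod_triangulation \<T> \<longleftrightarrow>
     triangulation \<T> \<and>
     (\<forall>P\<in>\<T>. (int CARD('r) + int CARD('e) - 2) simplex P \<and>
        {v. v extreme_point_of P} \<subseteq> {prod_vertex i j | i j. True}) \<and>
     \<Union>\<T> = std_simplex \<times> std_simplex"

definition tree_of :: "((real ^ 'r) \<times> (real ^ 'e)) set \<Rightarrow> ('r \<times> 'e) set" where
  "tree_of P = {(i, j). prod_vertex i j extreme_point_of P}"

definition extend_tree :: "('r \<times> 'e) set \<Rightarrow> ('r \<times> ('r + 'e)) set" where
  "extend_tree t = {(i, Inl i) | i. True} \<union> {(i, Inr j) | i j. (i, j) \<in> t}"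

definition extended_trees ::
  "((real ^ 'r) \<times> (real ^ 'e)) set set \<Rightarrow> ('r \<times> ('r + 'e)) set set" where
  "extended_trees \<T> = (\<lambda>P. extend_tree (tree_of P)) ` \<T>"

definition row_isolated :: "('r \<times> 'c) set \<Rightarrow> 'r \<Rightarrow> bool" where
  "row_isolated F i \<longleftrightarrow> (\<forall>j. (i, j) \<notin> F)"

definition col_isolated :: "('r \<times> 'c) set \<Rightarrow> 'c \<Rightarrow> bool" where
  "col_isolated F j \<longleftrightarrow> (\<forall>i. (i, j) \<notin> F)"


section \<open>Matching fields and their chirotopes\<close>

definition perfect_matching :: "'c set \<Rightarrow> ('r \<times> 'c) set \<Rightarrow> bool" where
  "perfect_matching \<sigma> M \<longleftrightarrow>
     M \<subseteq> UNIV \<times> \<sigma> \<and> (\<forall>i. \<exists>!j. (i, j) \<in> M) \<and> (\<forall>j\<in>\<sigma>. \<exists>!i. (i, j) \<in> M)"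

definition matching_field :: "('r \<times> 'c) set set \<Rightarrow> 'c set \<Rightarrow> ('r \<times> 'c) set" where
  "matching_field trees \<sigma> = (THE M. perfect_matching \<sigma> M \<and> (\<exists>t\<in>trees. M \<subseteq> t))"

text \<open>On a finite set \<open>X\<close>, \<open>position X\<close> is the order-preserving bijection onto \<open>{0..<card X}\<close>.\<close>

definition position :: "'a::linorder set \<Rightarrow> 'a \<Rightarrow> nat" where
  "position X x = card {y \<in> X. y < x}"

text \<open>
  The permutation \<open>[d] \<rightarrow> R \<rightarrow> \<sigma> \<rightarrow> [d]\<close>, with \<open>[d]\<close> rendered as \<open>{0..<d}\<close> and extended by the
  identity to all of \<open>nat\<close>.
\<close>

definition matching_perm ::
  "'c::linorder set \<Rightarrow> ('r::{finite,linorder} \<times> 'c) set \<Rightarrow> nat \<Rightarrow> nat" where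
  "matching_perm \<sigma> M k =
     (if k < CARD('r)
      then position \<sigma> (THE j. (sorted_list_of_set (UNIV :: 'r set) ! k, j) \<in> M)
      else k)"

definition matching_chirotope ::
  "('r::{finite,linorder} \<times> 'c::linorder) set set \<Rightarrow> ('r \<Rightarrow> 'c \<Rightarrow> int) \<Rightarrow> 'c set \<Rightarrow> int" where
  "matching_chirotope trees A \<sigma> =
     (let M = matching_field trees \<sigma>
      in sign (matching_perm \<sigma> M) * (\<Prod>(i, j)\<in>M. A i j))"


section \<open>Covectors of the oriented matroid given by a chirotope\<close>

text \<open>
  A chirotope \<open>chi\<close> of rank \<open>d\<close> is given by its values on \<open>d\<close>-subsets, i.e. on increasing tuples.
  On arbitrary tuples it is the alternating extension of these values.
\<close>

definition tuple_perm :: "'c::linorder list \<Rightarrow> nat \<Rightarrow> nat" where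
  "tuple_perm xs k = (if k < length xs then position (set xs) (xs ! k) else k)"

definition alternating_ext :: "('c::linorder set \<Rightarrow> int) \<Rightarrow> 'c list \<Rightarrow> int" where
  "alternating_ext chi xs = (if distinct xs then sign (tuple_perm xs) * chi (set xs) else 0)"

text \<open>
  The signed cocircuits of the oriented matroid with chirotope \<open>chi\<close> are the non-zero sign vectors
  \<open>\<plusminus>(chi (y, x\<^sub>2, \<dots>, x\<^sub>d))\<^sub>y\<close>.
\<close>

definition cocircuits :: "nat \<Rightarrow> ('c::linorder set \<Rightarrow> int) \<Rightarrow> ('c \<Rightarrow> int) set" where
  "cocircuits d chi =
     {C. C \<noteq> (\<lambda>_. 0) \<and>
         (\<exists>xs. \<exists>s\<in>{-1, 1}. Suc (length xs) = d \<and>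
            C = (\<lambda>y. s * alternating_ext chi (y # xs)))}"

definition sign_compose :: "('c \<Rightarrow> int) \<Rightarrow> ('c \<Rightarrow> int) \<Rightarrow> 'c \<Rightarrow> int" where
  "sign_compose X Y y = (if X y \<noteq> 0 then X y else Y y)"

inductive_set covectors :: "nat \<Rightarrow> ('c::linorder set \<Rightarrow> int) \<Rightarrow> ('c \<Rightarrow> int) set"
  for d :: nat and chi :: "'c set \<Rightarrow> int" where
  zero: "(\<lambda>_. 0) \<in> covectors d chi"
| compose: "C \<in> cocircuits d chi \<Longrightarrow> X \<in> covectors d chi \<Longrightarrow> sign_compose C X \<in> covectors d chi"


section \<open>The extended sign matrix and the map psi\<close>

text \<open>The matrix \<open>(I | A)\<close>.\<close>

fun extend_matrix :: "('r \<Rightarrow> 'e \<Rightarrow> int) \<Rightarrow> 'r \<Rightarrow> 'r + 'e \<Rightarrow> int" where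
  "extend_matrix A i (Inl k) = (if i = k then 1 else 0)"
| "extend_matrix A i (Inr j) = A i j"

definition restricted_matrix ::
  "('r \<Rightarrow> 'c \<Rightarrow> int) \<Rightarrow> ('r \<Rightarrow> int) \<Rightarrow> ('r \<times> 'c) set \<Rightarrow> 'r \<Rightarrow> 'c \<Rightarrow> int" where
  "restricted_matrix A S F i j = (if (i, j) \<in> F then S i * A i j else 0)"

definition psi ::
  "('r \<Rightarrow> 'c \<Rightarrow> int) \<Rightarrow> ('r \<Rightarrow> int) \<Rightarrow> ('r \<times> 'c) set \<Rightarrow> 'c \<Rightarrow> int" where
  "psi A S F j =
     (let B = restricted_matrix A S F
      in if (\<exists>i. B i j > 0) \<and> (\<exists>i. B i j < 0) \<or> (\<forall>i. B i j = 0) then 0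
         else if \<forall>i. B i j \<ge> 0 then 1
         else -1)"

end

theory Submission
  imports Defs
begin

text \<open>
  Deleting edges that do not change the sign vector, we may assume that each column of the subgraph
  on \<open>R\<close> and \<open>E\<close> has at most one neighbour of each sign, so that its sign is zero exactly when it has
  two. Let \<open>D\<close> be the set of rows whose pendant edge is kept. If these zero columns connect all of \<open>D\<close>,
  then the zero set of the vector consists of \<open>|D| - 1\<close> columns in \<open>E\<close> and \<open>d - |D|\<close> copies of rows,
  and the vector is the cocircuit defined by this \<open>(d - 1)\<close>-set. Otherwise \<open>D\<close> splits into two parts
  that share no column. Shifting mass in \<open>\<triangle>\<^bsub>d-1\<^esub>\<close> towards one part, with the marginal on
  \<open>\<triangle>\<^bsub>n-1\<^esub>\<close> fixed, moves into a simplex of the triangulation that has a new edge from a row of this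
  part to a foreign column. Repeating this, either a column becomes zero or the part absorbs all
  columns and the other rows can be dropped. In both cases one obtains by induction a covector that
  agrees with the given vector on the chosen part and is zero or equal to it elsewhere. The
  composition of the covectors for the two parts is the given vector.
\<close>

section \<open>Trees of a triangulation of a product of simplices\<close>

lemma inner_prod_vertex: "prod_vertex i j \<bullet> z = fst z $ i + snd z $ j"
  by (simp add: prod_vertex_def inner_axis' inner_prod_def)

definition vtx :: "'r::finite \<times> 'e::finite \<Rightarrow> (real ^ 'r) \<times> (real ^ 'e)" where
  "vtx e = prod_vertex (fst e) (snd e)"

lemma vtx_eq_iff [simp]: "vtx e = vtx f \<longleftrightarrow> e = f"
  by (auto simp: vtx_def prod_vertex_def axis_eq_axis prod_eq_iff)

lemma inj_vtx: "inj_on vtx X"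
  by (simp add: inj_on_def)

lemma inner_vtx: "vtx e \<bullet> z = fst z $ fst e + snd z $ snd e"
  by (simp add: vtx_def inner_prod_vertex)

lemma mem_tree_of: "e \<in> tree_of P \<longleftrightarrow> vtx e extreme_point_of P"
  by (simp add: tree_of_def vtx_def case_prod_beta)

definition barycenter :: "('r::finite \<times> 'e::finite) set \<Rightarrow> (real ^ 'r) \<times> (real ^ 'e)" where
  "barycenter F = (1 / real (card F)) *\<^sub>R (\<Sum>e\<in>F. vtx e)"

locale product_triangulation =
  fixes \<T> :: "((real ^ 'r::finite) \<times> (real ^ 'e::finite)) set set"
  assumes triangulation: "prod_triangulation \<T>"
begin

lemma
  assumes "P \<in> \<T>"
  shows simplex_eq_hull: "P = convex hull (vtx ` tree_of P)"
    and tree_affine_independent: "\<not> affine_dependent (vtx ` tree_of P)"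
proof -
  from assms triangulation obtain C where C: "\<not> affine_dependent C" "P = convex hull C"
    unfolding prod_triangulation_def simplex_def by blast
  have ext: "v extreme_point_of P \<longleftrightarrow> v \<in> C" for v
    using C by (simp add: extreme_point_of_convex_hull_affine_independent)
  have "C \<subseteq> {prod_vertex i j | i j. True}"
    using assms triangulation ext unfolding prod_triangulation_def by blast
  moreover have "prod_vertex i j = vtx (i, j)" for i :: 'r and j :: 'e
    by (simp add: vtx_def)
  ultimately have "C \<subseteq> range vtx"
    by auto
  moreover have "tree_of P = {e. vtx e \<in> C}"
    by (intro set_eqI) (simp only: mem_Collect_eq mem_tree_of ext)
  ultimately have "vtx ` tree_of P = C"
    by blast
  with C show "P = convex hull (vtx ` tree_of P)" "\<not> affine_dependent (vtx ` tree_of P)"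
    by auto
qed

lemma hull_subset_simplex: "P \<in> \<T> \<Longrightarrow> F \<subseteq> tree_of P \<Longrightarrow> convex hull (vtx ` F) \<subseteq> P"
  using simplex_eq_hull[of P] hull_mono[of "vtx ` F" "vtx ` tree_of P" convex] by blast

lemma closed_simplex_of: "P \<in> \<T> \<Longrightarrow> closed P"
  using triangulation closed_simplex unfolding prod_triangulation_def by blast

text \<open>Extending the convex weights by zero to all edges lets later arguments test a point
  against linear functionals with sums over \<open>UNIV\<close>.\<close>

lemma simplex_weights:
  assumes "P \<in> \<T>" "x \<in> P"
  obtains w where "\<And>e. 0 \<le> w e" "\<And>e. e \<notin> tree_of P \<Longrightarrow> w e = 0" "sum w UNIV = 1"
    "\<And>z. x \<bullet> z = (\<Sum>e\<in>UNIV. w e * (fst z $ fst e + snd z $ snd e))"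
proof -
  have "x \<in> convex hull (vtx ` tree_of P)"
    using assms simplex_eq_hull by auto
  then obtain u where u: "\<forall>v\<in>vtx ` tree_of P. 0 \<le> u v" "sum u (vtx ` tree_of P) = 1"
    "(\<Sum>v\<in>vtx ` tree_of P. u v *\<^sub>R v) = x"
    by (auto simp: convex_hull_finite)
  define w where "w e = (if e \<in> tree_of P then u (vtx e) else 0)" for e
  have 1: "sum w UNIV = 1"
    using u(2) by (simp add: w_def sum.If_cases sum.reindex[OF inj_vtx])
  have "(\<Sum>e\<in>tree_of P. u (vtx e) *\<^sub>R vtx e) = x"
    using u(3) by (simp add: sum.reindex[OF inj_vtx])
  then have x: "x \<bullet> z = (\<Sum>e\<in>tree_of P. w e * (fst z $ fst e + snd z $ snd e))" for z
    by (auto simp: inner_sum_left inner_vtx w_def)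
  have 2: "x \<bullet> z = (\<Sum>e\<in>UNIV. w e * (fst z $ fst e + snd z $ snd e))" for z
    unfolding x by (rule sum.mono_neutral_left) (auto simp: w_def)
  show ?thesis
    by (rule that[OF _ _ 1 2]) (use u(1) in \<open>auto simp: w_def\<close>)
qed

text \<open>The functional with blocks \<open>axis (fst e) 1\<close> and
  \<open>axis (snd e) 1\<close> is 2 at \<open>vtx e\<close> and at most 1 at any other vertex, so
  convex combinations of other vertices miss \<open>vtx e\<close>.\<close>

lemma vertex_in_tree:
  assumes "P \<in> \<T>" "vtx e \<in> P"
  shows "e \<in> tree_of P"
proof (rule ccontr)
  assume e: "e \<notin> tree_of P"
  obtain w where w: "\<And>e. 0 \<le> w e" "\<And>e. e \<notin> tree_of P \<Longrightarrow> w e = 0" "sum w UNIV = 1"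
    "\<And>z. vtx e \<bullet> z = (\<Sum>e\<in>UNIV. w e * (fst z $ fst e + snd z $ snd e))"
    using simplex_weights[OF assms] by blast
  have "2 = (\<Sum>f\<in>UNIV. w f * (axis (fst e) 1 $ fst f + axis (snd e) 1 $ snd f))"
    using w(4)[of "(axis (fst e) 1, axis (snd e) 1)"] by (simp add: inner_vtx)
  also have "\<dots> \<le> (\<Sum>f\<in>UNIV. w f * 1)"
  proof (rule sum_mono)
    fix f
    show "w f * (axis (fst e) 1 $ fst f + axis (snd e) 1 $ snd f) \<le> w f * 1"
      using w(1)[of f] w(2)[OF e] by (cases "fst f = fst e"; cases "snd f = snd e") (auto simp: axis_def prod_eqI dest: prod_eqI)
  qed
  finally show False
    using w(3) by simp
qed

text \<open>The barycenter lies in the relative interior of the hull of \<open>F\<close>, and a face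
  of \<open>P\<close> meeting the relative interior of a subset of \<open>P\<close> contains that
  subset.\<close>

lemma barycenter_in_simplex_imp_subset_tree:
  assumes "P \<in> \<T>" "F \<subseteq> tree_of P" "F \<noteq> {}" "Q \<in> \<T>" "barycenter F \<in> Q"
  shows "F \<subseteq> tree_of Q"
proof -
  have face: "P \<inter> Q face_of P"
    using assms triangulation unfolding prod_triangulation_def triangulation_def by blast
  have "card F > 0"
    using assms(3) by (simp add: card_gt_0_iff)
  then have "barycenter F \<in> rel_interior (convex hull (vtx ` F))"
    by (intro subsetD[OF explicit_subset_rel_interior_convex_hull_minimal])
      (auto simp: barycenter_def sum.reindex[OF inj_vtx] scaleR_right.sum
        intro!: exI[of _ "\<lambda>_. 1 / real (card F)"])
  moreover have sub: "convex hull (vtx ` F) \<subseteq> P"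
    using assms(1,2) by (rule hull_subset_simplex)
  ultimately have "convex hull (vtx ` F) \<subseteq> P \<inter> Q"
    using rel_interior_subset assms(5) by (intro subset_of_face_of[OF face]) blast+
  then have "vtx ` F \<subseteq> Q"
    using hull_subset[of "vtx ` F" convex] by blast
  then show ?thesis
    using vertex_in_tree[OF assms(4)] by blast
qed

text \<open>
  All vertices lie in an affine hyperplane missing the origin, so affine independence is linear
  independence, and a linear functional isolates each vertex. Its two blocks of coordinates form
  a potential on the nodes, whose level sets cut the tree at one edge.
\<close>

lemma tree_potential:
  assumes "P \<in> \<T>" "e \<in> tree_of P"
  obtains z where "\<And>f. f \<in> tree_of P \<Longrightarrow> f \<noteq> e \<Longrightarrow> vtx f \<bullet> z = 0" "vtx e \<bullet> z \<noteq> 0"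
proof -
  let ?X = "vtx ` (tree_of P - {e})"
  have fin: "finite ?X" by simp
  \<comment> \<open>\<open>h\<close> sums the row coordinates, so it is 1 on every vertex and shows
    that a linear combination of vertices equal to a vertex is affine.\<close>
  define h :: "(real ^ 'r) \<times> (real ^ 'e)" where "h = ((\<chi> i. 1), 0)"
  have h: "v \<bullet> h = 1" if "v \<in> range vtx" for v
    using that by (auto simp: inner_vtx h_def)
  have "vtx e \<notin> span ?X"
  proof
    assume "vtx e \<in> span ?X"
    then obtain u where u: "vtx e = (\<Sum>v\<in>?X. u v *\<^sub>R v)"
      using span_finite[OF fin] by auto
    have "1 = vtx e \<bullet> h"
      using h[of "vtx e"] by simp
    also have "\<dots> = (\<Sum>v\<in>?X. u v * (v \<bullet> h))"
      unfolding u by (simp add: inner_sum_left)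
    also have "\<dots> = sum u ?X"
      by (rule sum.cong) (use h in auto)
    finally have "vtx e \<in> affine hull ?X"
      unfolding affine_hull_finite[OF fin] mem_Collect_eq
      using u by (intro exI[of _ u] conjI) simp_all
    moreover have "?X = vtx ` tree_of P - {vtx e}"
      by auto
    ultimately show False
      using tree_affine_independent[OF assms(1)] assms(2) unfolding affine_dependent_def
      by (metis image_eqI)
  qed
  \<comment> \<open>\<open>z\<close> is the component of \<open>vtx e\<close> orthogonal to the
    other vertices, non-zero because \<open>vtx e\<close> is outside their span.\<close>
  moreover obtain y z where yz: "y \<in> span ?X" "\<And>w. w \<in> span ?X \<Longrightarrow> orthogonal z w" "vtx e = y + z"
    using orthogonal_subspace_decomp_exists[of ?X "vtx e"] by blast
  ultimately have "z \<noteq> 0" by auto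
  have "y \<bullet> z = 0"
    using yz(2)[OF yz(1)] by (simp add: orthogonal_def inner_commute)
  then have "vtx e \<bullet> z = z \<bullet> z"
    unfolding yz(3) by (simp add: inner_add_left)
  moreover have "vtx f \<bullet> z = 0" if "f \<in> tree_of P" "f \<noteq> e" for f
    using yz(2)[OF span_base[of "vtx f"]] that by (auto simp: orthogonal_def inner_commute)
  ultimately show ?thesis
    using that[of z] \<open>z \<noteq> 0\<close> by auto
qed

text \<open>With column potentials negated, every edge other than \<open>(i, j)\<close> has equal
  potentials at its ends, so only \<open>(i, j)\<close> leaves the level set of \<open>i\<close>.
  This is the form of acyclicity used in \<open>push_up\<close> and
  \<open>connected_configuration_spanning\<close>.\<close>

lemma tree_cut:
  assumes "P \<in> \<T>" "(i, j) \<in> tree_of P"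
  obtains U V where "i \<in> U" "j \<notin> V"
    "\<And>a b. (a, b) \<in> tree_of P \<Longrightarrow> (a, b) \<noteq> (i, j) \<Longrightarrow> a \<in> U \<longleftrightarrow> b \<in> V"
proof -
  obtain z where z: "\<And>f. f \<in> tree_of P \<Longrightarrow> f \<noteq> (i, j) \<Longrightarrow> vtx f \<bullet> z = 0" "vtx (i, j) \<bullet> z \<noteq> 0"
    using tree_potential[OF assms] by blast
  show ?thesis
  proof (rule that[of "{a. fst z $ a = fst z $ i}" "{b. - (snd z $ b) = fst z $ i}"])
    show "j \<notin> {b. - (snd z $ b) = fst z $ i}"
      using z(2) by (auto simp: inner_vtx)
    fix a b assume "(a, b) \<in> tree_of P" "(a, b) \<noteq> (i, j)"
    from z(1)[OF this] have "fst z $ a = - (snd z $ b)"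
      by (simp add: inner_vtx)
    then show "a \<in> {a. fst z $ a = fst z $ i} \<longleftrightarrow> b \<in> {b. - (snd z $ b) = fst z $ i}"
      by auto
  qed simp
qed

text \<open>The vertex sum determines the barycenter, hence \<open>M\<close> also lies in the tree
  of \<open>Q\<close>. There, a potential isolating an edge of \<open>M\<close> outside
  \<open>N\<close> would tell the two sums apart. Since the sum records the node degrees, this gives
  uniqueness of matchings.\<close>

lemma subtree_eqI:
  assumes "P \<in> \<T>" "M \<subseteq> tree_of P" "Q \<in> \<T>" "N \<subseteq> tree_of Q"
    and eq: "(\<Sum>e\<in>M. vtx e) = (\<Sum>e\<in>N. vtx e)"
  shows "M = N"
proof -
  have "real (card M) = (\<Sum>e\<in>M. vtx e) \<bullet> ((\<chi> i. 1), 0)"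
    by (simp add: inner_sum_left inner_vtx)
  also have "\<dots> = real (card N)"
    unfolding eq by (simp add: inner_sum_left inner_vtx)
  finally have card: "card M = card N" by simp
  show ?thesis
  proof (cases "M = {}")
    case True
    with card show ?thesis by simp
  next
    case False
    with card have "N \<noteq> {}" by auto
    have bary: "barycenter M = barycenter N"
      using card eq by (simp add: barycenter_def)
    have "barycenter N \<in> convex hull (vtx ` N)"
      using explicit_subset_rel_interior_convex_hull_minimal[of "vtx ` N"] \<open>N \<noteq> {}\<close>
      unfolding barycenter_def scaleR_right.sum
      by (subst convex_hull_finite)
        (auto simp: sum.reindex[OF inj_vtx] card_gt_0_iff intro!: exI[of _ "\<lambda>_. 1 / real (card N)"])
    also have "\<dots> \<subseteq> Q"
      using assms(3,4) by (rule hull_subset_simplex)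
    finally have "M \<subseteq> tree_of Q"
      using barycenter_in_simplex_imp_subset_tree[OF assms(1,2) False assms(3)] bary by simp
    have "e \<in> N" if "e \<in> M" for e
    proof (rule ccontr)
      assume "e \<notin> N"
      have "e \<in> tree_of Q"
        using that \<open>M \<subseteq> tree_of Q\<close> by blast
      then obtain z where z: "\<And>f. f \<in> tree_of Q \<Longrightarrow> f \<noteq> e \<Longrightarrow> vtx f \<bullet> z = 0" "vtx e \<bullet> z \<noteq> 0"
        using tree_potential[OF assms(3)] by blast
      have "(\<Sum>f\<in>M. vtx f) \<bullet> z = (\<Sum>f\<in>M. if f = e then vtx e \<bullet> z else 0)"
        unfolding inner_sum_left
        by (rule sum.cong) (use z(1) \<open>M \<subseteq> tree_of Q\<close> in auto)
      also have "\<dots> = vtx e \<bullet> z"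
        using that by simp
      also have "(\<Sum>f\<in>M. vtx f) \<bullet> z = 0"
        unfolding eq inner_sum_left
        by (rule sum.neutral) (use z(1) assms(4) \<open>e \<notin> N\<close> in auto)
      finally show False
        using z(2) by simp
    qed
    then show ?thesis
      using card by (intro card_subset_eq) auto
  qed
qed

text \<open>Moving the weight of \<open>(i0, j0)\<close> to a row of \<open>K\<close> keeps the
  column marginal but raises the row marginal on \<open>K\<close>. A small such move from the
  barycenter of \<open>F\<close> ends in a simplex that still contains \<open>F\<close> and needs an
  edge across the cut.\<close>

lemma tree_edge_across_cut:
  assumes "P \<in> \<T>" "F \<subseteq> tree_of P" "(i0, j0) \<in> F" "i0 \<notin> K" "r \<in> K"
    and closed: "\<And>i j. (i, j) \<in> F \<Longrightarrow> i \<in> K \<longleftrightarrow> j \<in> L"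
  obtains Q i j where "Q \<in> \<T>" "F \<subseteq> tree_of Q" "(i, j) \<in> tree_of Q" "i \<in> K" "j \<notin> L"
proof -
  let ?m = "real (card F)"
  have m: "?m > 0"
    using assms(3) by (auto simp: card_gt_0_iff)
  have "j0 \<notin> L"
    using assms(3,4) closed by blast
  \<comment> \<open>The points \<open>x n\<close> run from \<open>q\<close> towards the barycenter
    of \<open>F\<close>. They stay in the product by convexity, whether or not the rerouted edge
    lies in a common tree with the rest.\<close>
  define g where "g e = (if e = (i0, j0) then (r, j0) else e)" for e
  define q where "q = (1 / ?m) *\<^sub>R (\<Sum>e\<in>F. vtx (g e))"
  define x where "x n = (1 - 1 / real (Suc n)) *\<^sub>R barycenter F + (1 / real (Suc n)) *\<^sub>R q" for n
  have vtx_in: "vtx e \<in> std_simplex \<times> std_simplex" for e :: "'r \<times> 'e"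
    by (auto simp: vtx_def prod_vertex_def std_simplex_def intro!: hull_inc)
  have convex: "convex (std_simplex \<times> std_simplex :: ((real ^ 'r) \<times> (real ^ 'e)) set)"
    by (intro convex_Times) (auto simp: std_simplex_def)
  have "x n \<in> \<Union>\<T>" for n
  proof -
    have "barycenter F \<in> std_simplex \<times> std_simplex" "q \<in> std_simplex \<times> std_simplex"
      unfolding barycenter_def q_def scaleR_right.sum
      by (intro convex_sum[OF _ convex]; use m vtx_in in auto)+
    then have "x n \<in> std_simplex \<times> std_simplex"
      unfolding x_def by (intro convexD[OF convex]) (auto simp: field_simps)
    then show ?thesis
      using triangulation unfolding prod_triangulation_def by simp
  qed
  then have "\<forall>n. \<exists>P. P \<in> \<T> \<and> x n \<in> P"
    by blast
  then obtain p where p: "\<And>n. p n \<in> \<T>" "\<And>n. x n \<in> p n"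
    by metis
  have "finite \<T>"
    using triangulation unfolding prod_triangulation_def triangulation_def by blast
  then have "finite (range p)"
    by (rule finite_subset[rotated]) (use p in auto)
  \<comment> \<open>One simplex contains \<open>x n\<close> for infinitely many \<open>n\<close>;
    being closed, it contains their limit.\<close>
  then obtain n0 where inf: "infinite {n. p n = p n0}"
    using pigeonhole_infinite[of UNIV p] by auto
  define Q where "Q = p n0"
  have "Q \<in> \<T>" "x n0 \<in> Q"
    using p by (auto simp: Q_def)
  have "barycenter F \<in> Q"
  proof (rule ccontr)
    assume "barycenter F \<notin> Q"
    have "(\<lambda>n. (1 - 1 / real (Suc n)) *\<^sub>R barycenter F + (1 / real (Suc n)) *\<^sub>R q)
        \<longlonglongrightarrow> (1 - 0) *\<^sub>R barycenter F + 0 *\<^sub>R q"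
      by (intro tendsto_intros LIMSEQ_Suc lim_const_over_n)
    then have "x \<longlonglongrightarrow> barycenter F"
      by (simp add: x_def[abs_def])
    then have "eventually (\<lambda>n. x n \<in> - Q) sequentially"
      by (rule topological_tendstoD)
        (use \<open>barycenter F \<notin> Q\<close> closed_simplex_of[OF \<open>Q \<in> \<T>\<close>] in auto)
    then have "finite {n. x n \<in> Q}"
      by (simp add: eventually_cofinite flip: cofinite_eq_sequentially)
    moreover have "{n. p n = p n0} \<subseteq> {n. x n \<in> Q}"
      using p(2) by (auto simp: Q_def)
    ultimately show False
      using inf finite_subset by blast
  qed
  then have "F \<subseteq> tree_of Q"
    using barycenter_in_simplex_imp_subset_tree[OF assms(1,2) _ \<open>Q \<in> \<T>\<close>] assms(3) by blast
  obtain w where w: "\<And>e. 0 \<le> w e" "\<And>e. e \<notin> tree_of Q \<Longrightarrow> w e = 0" "sum w UNIV = 1"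
    "\<And>z. x n0 \<bullet> z = (\<Sum>e\<in>UNIV. w e * (fst z $ fst e + snd z $ snd e))"
    using simplex_weights[OF \<open>Q \<in> \<T>\<close> \<open>x n0 \<in> Q\<close>] by blast
  \<comment> \<open>\<open>zK\<close> measures mass on \<open>K\<close> minus mass on
    \<open>L\<close>: zero on \<open>F\<close>, one on the rerouted edge, and positive only on edges
    from \<open>K\<close> to a column outside \<open>L\<close>.\<close>
  define zK :: "(real ^ 'r) \<times> (real ^ 'e)" where
    "zK = ((\<chi> i. of_bool (i \<in> K)), (\<chi> j. - of_bool (j \<in> L)))"
  have gK: "vtx e \<bullet> zK = 0" if "e \<in> F" for e
    using that closed by (cases e) (auto simp: zK_def inner_vtx)
  have "(\<Sum>e\<in>F. vtx (g e) \<bullet> zK) = (\<Sum>e\<in>F. if e = (i0, j0) then 1 else 0)"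
  proof (rule sum.cong)
    fix e assume "e \<in> F"
    then show "vtx (g e) \<bullet> zK = (if e = (i0, j0) then 1 else 0)"
      using gK[of e] \<open>r \<in> K\<close> \<open>j0 \<notin> L\<close> by (auto simp: g_def) (auto simp: zK_def inner_vtx)
  qed simp
  also have "\<dots> = 1"
    using assms(3) by simp
  finally have "q \<bullet> zK = 1 / ?m"
    by (simp add: q_def inner_sum_left)
  moreover have "barycenter F \<bullet> zK = 0"
    by (simp add: barycenter_def inner_sum_left gK)
  ultimately have "x n0 \<bullet> zK > 0"
    using m by (simp add: x_def inner_add_left)
  then have "(\<Sum>e\<in>UNIV. w e * (of_bool (fst e \<in> K) - of_bool (snd e \<in> L))) > 0"
    unfolding w(4) by (simp add: zK_def)
  then obtain e where e: "w e * (of_bool (fst e \<in> K) - of_bool (snd e \<in> L)) > 0"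
    by (metis (no_types, lifting) not_less sum_nonpos)
  then have "w e \<noteq> 0" "fst e \<in> K" "snd e \<notin> L"
    using w(1)[of e] by (auto simp: of_bool_def split: if_splits)
  moreover have "e \<in> tree_of Q"
    using w(2) \<open>w e \<noteq> 0\<close> by blast
  ultimately show ?thesis
    using that[OF \<open>Q \<in> \<T>\<close> \<open>F \<subseteq> tree_of Q\<close>, of "fst e" "snd e"] by simp
qed

end

section \<open>Signs of matchings\<close>

lemma position_bij: "finite X \<Longrightarrow> bij_betw (position X) X {..<card X}"
proof -
  assume fin: "finite X"
  have less: "position X x < position X y" if "x \<in> X" "y \<in> X" "x < y" for x y
    unfolding position_def by (rule psubset_card_mono) (use fin that in auto)
  have inj: "inj_on (position X) X"
    by (rule inj_onI) (metis less less_irrefl linorder_neqE)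
  have "position X ` X \<subseteq> {..<card X}"
    using fin unfolding position_def by (auto intro!: psubset_card_mono)
  then have "position X ` X = {..<card X}"
    by (rule card_subset_eq[rotated]) (simp_all add: card_image[OF inj])
  with inj show ?thesis
    by (simp add: bij_betw_def)
qed

lemma tuple_perm_permutes:
  assumes "distinct xs"
  shows "tuple_perm xs permutes {..<length xs}"
proof (rule bij_imp_permutes)
  have "bij_betw (position (set xs) \<circ> (!) xs) {..<length xs} {..<length xs}"
    using bij_betw_nth[OF assms refl refl] position_bij[of "set xs"]
    by (auto simp: distinct_card[OF assms] intro: bij_betw_trans)
  then show "bij_betw (tuple_perm xs) {..<length xs} {..<length xs}"
    by (rule bij_betw_cong[THEN iffD1, rotated]) (simp add: tuple_perm_def)
qed (simp add: tuple_perm_def)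

text \<open>
  A matching of the rows with the entries of a tuple is recorded by the function \<open>n\<close> sending a
  row to the index of its partner, so that its sign no longer depends on the names of the entries.
\<close>

definition index_perm :: "('r::{finite,linorder} \<Rightarrow> nat) \<Rightarrow> nat \<Rightarrow> nat" where
  "index_perm n k = (if k < CARD('r) then n (sorted_list_of_set UNIV ! k) else k)"

lemma bij_betw_row_enumeration:
  "bij_betw (\<lambda>k. sorted_list_of_set (UNIV :: 'r::{finite,linorder} set) ! k) {..<CARD('r)} UNIV"
  by (rule bij_betw_nth) simp_all

lemma index_perm_permutes:
  fixes n :: "'r::{finite,linorder} \<Rightarrow> nat"
  assumes "bij_betw n UNIV {..<CARD('r)}"
  shows "index_perm n permutes {..<CARD('r)}"
proof (rule bij_imp_permutes)
  have "bij_betw (n \<circ> (\<lambda>k. sorted_list_of_set UNIV ! k)) {..<CARD('r)} {..<CARD('r)}"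
    using bij_betw_row_enumeration assms by (rule bij_betw_trans)
  then show "bij_betw (index_perm n) {..<CARD('r)} {..<CARD('r)}"
    by (rule bij_betw_cong[THEN iffD1, rotated]) (simp add: index_perm_def)
qed (simp add: index_perm_def)

text \<open>Exchanging two rows precomposes \<open>index_perm n\<close> with the transposition of
  their positions in the row enumeration.\<close>

lemma sign_index_perm_swap:
  fixes n :: "'r::{finite,linorder} \<Rightarrow> nat"
  assumes "bij_betw n UNIV {..<CARD('r)}" "r \<noteq> r'"
  shows "sign (index_perm (n \<circ> Transposition.transpose r r')) = - sign (index_perm n)"
proof -
  let ?row = "\<lambda>k. sorted_list_of_set (UNIV :: 'r set) ! k"
  note bij = bij_betw_row_enumeration[where 'r='r]
  obtain k k' where k: "k < CARD('r)" "?row k = r" "k' < CARD('r)" "?row k' = r'"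
    using bij unfolding bij_betw_def image_iff set_eq_iff by (metis UNIV_I lessThan_iff)
  have inj: "?row l = ?row m \<longleftrightarrow> l = m" if "l < CARD('r)" "m < CARD('r)" for l m
    using bij that unfolding bij_betw_def inj_on_def by blast
  have "index_perm (n \<circ> Transposition.transpose r r') = index_perm n \<circ> Transposition.transpose k k'"
  proof
    fix l
    show "index_perm (n \<circ> Transposition.transpose r r') l = (index_perm n \<circ> Transposition.transpose k k') l"
      using k inj[of l k] inj[of l k']
      by (cases "l = k"; cases "l = k'"; cases "l < CARD('r)")
        (auto simp: index_perm_def Transposition.transpose_def)
  qed
  moreover have "k \<noteq> k'"
    using k assms(2) by auto
  moreover have "permutation (index_perm n)"
    using index_perm_permutes[OF assms(1)] permutes_imp_permutation by blast
  ultimately show ?thesis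
    by (simp add: sign_compose permutation_swap_id sign_swap_id)
qed

lemma perfect_matching_tuple:
  fixes n :: "'r::{finite,linorder} \<Rightarrow> nat"
  assumes "distinct xs" "length xs = CARD('r)" "bij_betw n UNIV {..<CARD('r)}"
  shows "perfect_matching (set xs) {(i, xs ! n i) | i. True}"
proof -
  have "bij_betw ((!) xs \<circ> n) UNIV (set xs)"
    using assms(3) bij_betw_nth[OF assms(1) refl refl] unfolding assms(2) by (rule bij_betw_trans)
  then show ?thesis
    unfolding perfect_matching_def bij_betw_def inj_on_def by auto
qed

text \<open>\<open>matching_perm\<close> is \<open>tuple_perm xs\<close> after
  \<open>index_perm n\<close>, so the sign of \<open>tuple_perm xs\<close> occurs twice and cancels;
  the order of the ground set disappears.\<close>

lemma alternating_ext_matching_chirotope: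
  fixes n :: "'r::{finite,linorder} \<Rightarrow> nat" and xs :: "'c::linorder list"
  assumes xs: "distinct xs" "length xs = CARD('r)"
    and n: "bij_betw n UNIV {..<CARD('r)}"
    and M: "matching_field trees (set xs) = {(i, xs ! n i) | i. True}"
  shows "alternating_ext (matching_chirotope trees A) xs = sign (index_perm n) * (\<Prod>i\<in>UNIV. A i (xs ! n i))"
proof -
  let ?M = "{(i, xs ! n i) | i. True}"
  have lt: "n i < length xs" for i
    using n xs(2) unfolding bij_betw_def by auto
  have "matching_perm (set xs) ?M = tuple_perm xs \<circ> index_perm n"
    using lt xs(2) by (auto simp: fun_eq_iff matching_perm_def index_perm_def tuple_perm_def)
  moreover have "permutation (index_perm n)" "permutation (tuple_perm xs)"
    using index_perm_permutes[OF n] tuple_perm_permutes[OF xs(1)] permutes_imp_permutation by blast+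
  ultimately have "sign (matching_perm (set xs) ?M) = sign (tuple_perm xs) * sign (index_perm n)"
    by (simp add: sign_compose)
  moreover have "(\<Prod>(i, j)\<in>?M. A i j) = (\<Prod>i\<in>UNIV. A i (xs ! n i))"
  proof -
    have "?M = (\<lambda>i. (i, xs ! n i)) ` UNIV" by auto
    then show ?thesis
      by (simp add: prod.reindex inj_on_def)
  qed
  moreover have "sign (tuple_perm xs) * sign (tuple_perm xs) = 1"
    by (rule sign_idempotent)
  ultimately show ?thesis
    using xs(1) M by (simp add: alternating_ext_def matching_chirotope_def flip: mult.assoc)
qed

section \<open>Compositions of covectors\<close>

lemma cocircuit_imp_covector:
  assumes "C \<in> cocircuits d chi"
  shows "C \<in> covectors d chi"
proof -
  have "sign_compose C (\<lambda>_. 0) = C"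
    by (auto simp: sign_compose_def)
  then show ?thesis
    using covectors.compose[OF assms covectors.zero] by simp
qed

lemma sign_compose_covectors:
  assumes "X \<in> covectors d chi" "Y \<in> covectors d chi"
  shows "sign_compose X Y \<in> covectors d chi"
  using assms(1)
proof induction
  case zero
  have "sign_compose (\<lambda>_. 0) Y = Y"
    by (auto simp: sign_compose_def)
  then show ?case
    using assms(2) by simp
next
  case (compose C X)
  have "sign_compose (sign_compose C X) Y = sign_compose C (sign_compose X Y)"
    by (auto simp: sign_compose_def)
  then show ?case
    using covectors.compose[OF compose.hyps(1) compose.IH] by simp
qed

section \<open>Uniqueness of matchings in the extended trees\<close>

text \<open>A copy \<open>Inl i\<close> can only be matched with row \<open>i\<close>, so exactly
  the rows whose copy is outside \<sigma> are matched into \<open>'e\<close>. The right-hand side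
  depends on \<sigma> alone, as \<open>subtree_eqI\<close> requires.\<close>

lemma sum_vtx_perfect_matching:
  fixes t :: "('r::finite \<times> 'e::finite) set"
  assumes "M \<subseteq> extend_tree t" "perfect_matching \<sigma> M"
  shows "(\<Sum>e\<in>{(i, j). (i, Inr j) \<in> M}. vtx e) =
    ((\<Sum>i | Inl i \<notin> \<sigma>. axis i 1), (\<Sum>j | Inr j \<in> \<sigma>. axis j 1))"
proof -
  let ?N = "{(i, j). (i, Inr j) \<in> M}"
  have Inl: "k = i" if "(i, Inl k) \<in> M" for i k
    using that assms(1) unfolding extend_tree_def by auto
  have pm: "\<And>i c. (i, c) \<in> M \<Longrightarrow> c \<in> \<sigma>" "\<And>i. \<exists>c. (i, c) \<in> M"
    "\<And>i c c'. (i, c) \<in> M \<Longrightarrow> (i, c') \<in> M \<Longrightarrow> c = c'"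
    "\<And>c. c \<in> \<sigma> \<Longrightarrow> \<exists>i. (i, c) \<in> M"
    "\<And>i i' c. (i, c) \<in> M \<Longrightarrow> (i', c) \<in> M \<Longrightarrow> i = i'"
    using assms(2) unfolding perfect_matching_def by blast+
  have "bij_betw fst ?N {i. Inl i \<notin> \<sigma>}"
  proof (rule bij_betw_imageI)
    show "inj_on fst ?N"
      using pm(3) by (auto simp: inj_on_def)
    show "fst ` ?N = {i. Inl i \<notin> \<sigma>}"
    proof (intro equalityI subsetI)
      fix i assume "i \<in> fst ` ?N"
      then obtain j where "(i, Inr j) \<in> M" by auto
      then show "i \<in> {i. Inl i \<notin> \<sigma>}"
        using pm(3,4) Inl by (metis mem_Collect_eq sum.distinct(1))
    next
      fix i assume "i \<in> {i. Inl i \<notin> \<sigma>}"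
      moreover obtain c where "(i, c) \<in> M" using pm(2) by blast
      ultimately obtain j where "(i, Inr j) \<in> M"
        using Inl pm(1) by (metis mem_Collect_eq sum.exhaust)
      then show "i \<in> fst ` ?N"
        by force
    qed
  qed
  then have fst: "(\<Sum>e\<in>?N. axis (fst e) 1) = (\<Sum>i | Inl i \<notin> \<sigma>. axis i 1 :: real ^ 'r)"
    by (rule sum.reindex_bij_betw)
  have "bij_betw snd ?N {j. Inr j \<in> \<sigma>}"
  proof (rule bij_betw_imageI)
    show "inj_on snd ?N"
      using pm(5) by (auto simp: inj_on_def)
    show "snd ` ?N = {j. Inr j \<in> \<sigma>}"
      using pm(1,4) by (fastforce simp: image_iff)
  qed
  then have "(\<Sum>e\<in>?N. axis (snd e) 1) = (\<Sum>j | Inr j \<in> \<sigma>. axis j 1 :: real ^ 'e)"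
    by (rule sum.reindex_bij_betw)
  with fst show ?thesis
    by (simp add: prod_eq_iff fst_sum snd_sum vtx_def prod_vertex_def)
qed

context product_triangulation
begin

text \<open>For two matchings of \<sigma>, \<open>subtree_eqI\<close> identifies the edges into
  \<open>'e\<close>, while the pendant edges are dictated by \<sigma>.\<close>

lemma matching_field_eqI:
  assumes P: "P \<in> \<T>" and M: "M \<subseteq> extend_tree (tree_of P)" and pm: "perfect_matching \<sigma> M"
  shows "matching_field (extended_trees \<T>) \<sigma> = M"
  unfolding matching_field_def
proof (rule the_equality)
  show "perfect_matching \<sigma> M \<and> (\<exists>t\<in>extended_trees \<T>. M \<subseteq> t)"
    using assms unfolding extended_trees_def by blast
next
  fix M' assume "perfect_matching \<sigma> M' \<and> (\<exists>t\<in>extended_trees \<T>. M' \<subseteq> t)"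
  then obtain Q where Q: "Q \<in> \<T>" "M' \<subseteq> extend_tree (tree_of Q)" "perfect_matching \<sigma> M'"
    unfolding extended_trees_def by auto
  have "{(i, j). (i, Inr j) \<in> M'} = {(i, j). (i, Inr j) \<in> M}"
  proof (rule subtree_eqI)
    show "{(i, j). (i, Inr j) \<in> M'} \<subseteq> tree_of Q" "{(i, j). (i, Inr j) \<in> M} \<subseteq> tree_of P"
      using M Q(2) unfolding extend_tree_def by auto
    show "(\<Sum>e\<in>{(i, j). (i, Inr j) \<in> M'}. vtx e) = (\<Sum>e\<in>{(i, j). (i, Inr j) \<in> M}. vtx e)"
      using sum_vtx_perfect_matching[OF Q(2,3)] sum_vtx_perfect_matching[OF M pm] by simp
  qed (use P Q in auto)
  then have "(i, Inr j) \<in> M' \<longleftrightarrow> (i, Inr j) \<in> M" for i j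
    by (auto simp: set_eq_iff)
  moreover have "(i, Inl k) \<in> N \<longleftrightarrow> k = i \<and> Inl i \<in> \<sigma>"
    if "N \<subseteq> extend_tree t" "perfect_matching \<sigma> N" for N and i k :: 'r and t :: "('r \<times> 'e) set"
  proof -
    have "k' = i'" if "(i', Inl k') \<in> N" for i' k'
      using that \<open>N \<subseteq> extend_tree t\<close> unfolding extend_tree_def by auto
    then show ?thesis
      using that(2) unfolding perfect_matching_def by blast
  qed
  note this[OF Q(2,3)] this[OF M pm]
  ultimately have "(i, c) \<in> M' \<longleftrightarrow> (i, c) \<in> M" for i c
    by (cases c) simp_all
  then show "M' = M"
    by auto
qed

end

section \<open>Configurations and their sign vectors\<close>

locale signed_triangulation = product_triangulation \<T>
  for \<T> :: "((real ^ 'r::{finite,linorder}) \<times> (real ^ 'e::{finite,linorder})) set set" +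
  fixes A :: "'r \<Rightarrow> 'e \<Rightarrow> int"
  assumes A_sign: "A i j \<in> {-1, 1}"
begin

abbreviation chi :: "('r + 'e) set \<Rightarrow> int" where
  "chi \<equiv> matching_chirotope (extended_trees \<T>) (extend_matrix A)"

definition col_signs :: "('r \<Rightarrow> int) \<Rightarrow> ('r \<times> 'e) set \<Rightarrow> 'e \<Rightarrow> int set" where
  "col_signs S G j = {S i * A i j | i. (i, j) \<in> G}"

definition conflicts :: "('r \<Rightarrow> int) \<Rightarrow> ('r \<times> 'e) set \<Rightarrow> 'e set" where
  "conflicts S G = {j. col_signs S G j = {-1, 1}}"

definition configuration :: "('r \<Rightarrow> int) \<Rightarrow> 'r set \<Rightarrow> ('r \<times> 'e) set \<Rightarrow> bool" where
  "configuration S D G \<longleftrightarrow>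
     (\<exists>P\<in>\<T>. G \<subseteq> tree_of P) \<and> fst ` G \<subseteq> D \<and> S ` D \<subseteq> {-1, 1} \<and> (\<forall>j. \<exists>i. (i, j) \<in> G) \<and>
     (\<forall>i i' j. (i, j) \<in> G \<longrightarrow> (i', j) \<in> G \<longrightarrow> S i * A i j = S i' * A i' j \<longrightarrow> i = i')"

text \<open>Since \<open>col_signs\<close> is a set, its sum is 0 for \<open>{-1, 1}\<close> and the
  common sign otherwise, as in \<open>psi\<close>.\<close>

definition config_vector :: "('r \<Rightarrow> int) \<Rightarrow> 'r set \<Rightarrow> ('r \<times> 'e) set \<Rightarrow> 'r + 'e \<Rightarrow> int" where
  "config_vector S D G y =
     (case y of Inl i \<Rightarrow> if i \<in> D then S i else 0 | Inr j \<Rightarrow> \<Sum>(col_signs S G j))"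

lemma config_vector_simps [simp]:
  "config_vector S D G (Inl i) = (if i \<in> D then S i else 0)"
  "config_vector S D G (Inr j) = \<Sum>(col_signs S G j)"
  by (simp_all add: config_vector_def)

lemma configurationD:
  assumes "configuration S D G"
  shows "\<exists>P\<in>\<T>. G \<subseteq> tree_of P"
    and "(i, j) \<in> G \<Longrightarrow> i \<in> D"
    and "i \<in> D \<Longrightarrow> S i \<in> {-1, 1}"
    and "\<exists>i. (i, j) \<in> G"
    and "(i, j) \<in> G \<Longrightarrow> (i', j) \<in> G \<Longrightarrow> S i * A i j = S i' * A i' j \<Longrightarrow> i = i'"
  using assms unfolding configuration_def by (blast, force, blast, blast, blast)

lemma configuration_entry_sign:
  assumes "configuration S D G" "(i, j) \<in> G"
  shows "S i * A i j \<in> {-1, 1}"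
  using configurationD(3)[OF assms(1) configurationD(2)[OF assms]] A_sign[of i j] by auto

lemma col_signs_cases:
  assumes "configuration S D G"
  obtains "col_signs S G j = {-1, 1}" | s where "s \<in> {-1, 1}" "col_signs S G j = {s}"
proof -
  have "col_signs S G j \<subseteq> {-1, 1}"
    using configuration_entry_sign[OF assms] unfolding col_signs_def by blast
  moreover have "col_signs S G j \<noteq> {}"
    using configurationD(4)[OF assms] unfolding col_signs_def by blast
  ultimately have "col_signs S G j = {-1, 1} \<or> col_signs S G j = {-1} \<or> col_signs S G j = {1}"
    by blast
  then show ?thesis
    using that by blast
qed

lemma entry_eq_if_nonconflict:
  assumes "configuration S D G" "(i, j) \<in> G" "j \<notin> conflicts S G"
  shows "col_signs S G j = {S i * A i j}"
proof -
  have "S i * A i j \<in> col_signs S G j"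
    using assms(2) unfolding col_signs_def by blast
  with col_signs_cases[OF assms(1), of j] assms(3) show ?thesis
    unfolding conflicts_def by (metis mem_Collect_eq singletonD)
qed

text \<open>
  Each step adds an edge \<open>(i, j)\<close> from \<open>K\<close> to a column outside \<open>L\<close>. If \<open>j\<close> already has a neighbour
  \<open>i'\<close> of the same sign, the new edge replaces \<open>(i', j)\<close> without changing the sign vector. The part
  then grows by everything that the cut at \<open>(i', j)\<close> separates from \<open>i'\<close>, which leaves out \<open>i'\<close>
  because the ambient tree is acyclic.
\<close>

lemma push_up:
  assumes IH: "\<And>D' G'. configuration S D' G' \<Longrightarrow> card D' + card (- conflicts S G') < N \<Longrightarrow>
      config_vector S D' G' \<in> covectors CARD('r) chi"
    and "configuration S D G" "card D + card (- conflicts S G) = N"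
    and "K \<subseteq> D" "K \<noteq> {}" "K \<noteq> D" "\<And>i j. (i, j) \<in> G \<Longrightarrow> i \<in> K \<longleftrightarrow> j \<in> L"
  shows "\<exists>X\<in>covectors CARD('r) chi. (\<forall>y. X y \<in> {0, config_vector S D G y}) \<and>
    (\<forall>i\<in>K. X (Inl i) = config_vector S D G (Inl i)) \<and>
    (\<forall>j\<in>L. X (Inr j) = config_vector S D G (Inr j))"
  using assms(2-)
\<comment> \<open>The inner induction serves the steps that keep the sign vector. Steps that change
  it drop rows or add a conflict, and fall under \<open>IH\<close>.\<close>
proof (induction "card (- L)" arbitrary: K L G rule: less_induct)
  case less
  note config = less.prems(1) and closed = less.prems(6)
  show ?case
  proof (cases "L = UNIV")
    case True
    have "fst ` G \<subseteq> K" "S ` K \<subseteq> {-1, 1}"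
      using closed True configurationD(3)[OF config] \<open>K \<subseteq> D\<close> by auto
    then have "configuration S K G"
      using config unfolding configuration_def by blast
    moreover have "card K < card D"
      using \<open>K \<subseteq> D\<close> \<open>K \<noteq> D\<close> by (simp add: psubset_card_mono psubset_eq)
    ultimately have "config_vector S K G \<in> covectors CARD('r) chi"
      using less.prems(2) by (intro IH) auto
    moreover have "config_vector S K G y \<in> {0, config_vector S D G y}" for y
      using \<open>K \<subseteq> D\<close> by (cases y) auto
    ultimately show ?thesis
      using \<open>K \<subseteq> D\<close> by (intro bexI[of _ "config_vector S K G"]) auto
  next
    case False
    then obtain j0 i0 where i0: "j0 \<notin> L" "(i0, j0) \<in> G"
      using configurationD(4)[OF config] by blast
    then have "i0 \<notin> K" using closed by blast
    obtain r where "r \<in> K" using \<open>K \<noteq> {}\<close> by blast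
    obtain P where "P \<in> \<T>" "G \<subseteq> tree_of P"
      using configurationD(1)[OF config] by blast
    then obtain Q i j where Q: "Q \<in> \<T>" "G \<subseteq> tree_of Q" "(i, j) \<in> tree_of Q" and ij: "i \<in> K" "j \<notin> L"
      using tree_edge_across_cut[OF _ _ i0(2) \<open>i0 \<notin> K\<close> \<open>r \<in> K\<close>] closed by metis
    have "i \<in> D" using ij \<open>K \<subseteq> D\<close> by blast
    have "(i, j) \<notin> G" using ij closed by blast
    have s: "S i * A i j \<in> {-1, 1}"
      using configurationD(3)[OF config \<open>i \<in> D\<close>] A_sign[of i j] by auto
    show ?thesis
    proof (cases "S i * A i j \<in> col_signs S G j")
      case True
      then obtain i' where i': "(i', j) \<in> G" "S i' * A i' j = S i * A i j"
        unfolding col_signs_def by auto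
      then have "i' \<in> D" "i' \<notin> K"
        using configurationD(2)[OF config] closed ij by blast+
      obtain U V where UV: "i' \<in> U" "j \<notin> V"
        "\<And>a b. (a, b) \<in> tree_of Q \<Longrightarrow> (a, b) \<noteq> (i', j) \<Longrightarrow> a \<in> U \<longleftrightarrow> b \<in> V"
        using tree_cut[OF Q(1), of i' j] i'(1) Q(2) by blast
      define G' where "G' = insert (i, j) (G - {(i', j)})"
      have signs: "col_signs S G' = col_signs S G"
      proof
        fix b
        show "col_signs S G' b = col_signs S G b"
          using i' unfolding col_signs_def G'_def by (cases "b = j") (auto, metis+)
      qed
      then have vec: "config_vector S D G' = config_vector S D G"
        by (intro ext) (simp only: config_vector_def)
      have config': "configuration S D G'"
        unfolding configuration_def
      proof (intro conjI allI impI)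
        show "\<exists>P\<in>\<T>. G' \<subseteq> tree_of P"
          using Q unfolding G'_def by blast
        show "fst ` G' \<subseteq> D"
          using configurationD(2)[OF config] \<open>i \<in> D\<close> unfolding G'_def by auto
        show "S ` D \<subseteq> {-1, 1}"
          using configurationD(3)[OF config] by blast
        show "\<exists>a. (a, b) \<in> G'" for b
          using configurationD(4)[OF config, of b] unfolding G'_def by blast
        show "a = a'" if "(a, b) \<in> G'" "(a', b) \<in> G'" "S a * A a b = S a' * A a' b" for a a' b
          using that configurationD(5)[OF config] i' unfolding G'_def by (metis DiffE Pair_inject insertE singletonI)
      qed
      \<comment> \<open>\<open>j\<close> is outside \<open>L\<close> and outside \<open>V\<close>,
        so the column part strictly grows.\<close>
      have "\<exists>X\<in>covectors CARD('r) chi. (\<forall>y. X y \<in> {0, config_vector S D G' y}) \<and>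
        (\<forall>i\<in>K \<union> (D - U). X (Inl i) = config_vector S D G' (Inl i)) \<and>
        (\<forall>j\<in>L \<union> - V. X (Inr j) = config_vector S D G' (Inr j))"
      proof (rule less.hyps[OF _ config'])
        show "card (- (L \<union> - V)) < card (- L)"
          by (rule psubset_card_mono) (use ij UV in auto)
        show "card D + card (- conflicts S G') = N"
          using less.prems(2) signs by (simp add: conflicts_def)
        show "K \<union> (D - U) \<subseteq> D" "K \<union> (D - U) \<noteq> {}" "K \<union> (D - U) \<noteq> D"
          using \<open>K \<subseteq> D\<close> \<open>K \<noteq> {}\<close> \<open>i' \<in> D\<close> \<open>i' \<notin> K\<close> UV(1) by blast+
        fix a b assume "(a, b) \<in> G'"
        then consider "a = i" "b = j" | "(a, b) \<in> G" "(a, b) \<noteq> (i', j)"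
          unfolding G'_def by blast
        then show "a \<in> K \<union> (D - U) \<longleftrightarrow> b \<in> L \<union> - V"
        proof cases
          case 1
          then show ?thesis using ij UV by simp
        next
          case 2
          then show ?thesis
            using closed[OF 2(1)] UV(3)[of a b] Q(2) configurationD(2)[OF config 2(1)] by blast
        qed
      qed
      then show ?thesis
        unfolding vec by blast
    next
      case False
      define G' where "G' = insert (i, j) G"
      have "insert (S i * A i j) (col_signs S G j) = {-1, 1}"
      proof (cases rule: col_signs_cases[OF config, of j])
        case 1
        with False s show ?thesis by simp
      next
        case (2 s')
        have "insert v {s'} = {-1, 1}" if "v \<in> {-1, 1}" "v \<noteq> s'" for v
          using that 2(1) by auto
        with False s 2(2) show ?thesis by simp
      qed
      moreover have "col_signs S G' b = (if b = j then insert (S i * A i j) (col_signs S G j) else col_signs S G b)" for b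
        unfolding col_signs_def G'_def by auto
      ultimately have signs: "col_signs S G' b = (if b = j then {-1, 1} else col_signs S G b)" for b
        by simp
      have "j \<notin> conflicts S G"
        using False s unfolding conflicts_def by auto
      moreover have "conflicts S G' = insert j (conflicts S G)"
        unfolding conflicts_def using signs by auto
      ultimately have "card (- conflicts S G') < card (- conflicts S G)"
        by (intro psubset_card_mono) auto
      moreover have "configuration S D G'"
        unfolding configuration_def
      proof (intro conjI allI impI)
        show "\<exists>P\<in>\<T>. G' \<subseteq> tree_of P"
          using Q unfolding G'_def by blast
        show "fst ` G' \<subseteq> D"
          using configurationD(2)[OF config] \<open>i \<in> D\<close> unfolding G'_def by auto
        show "S ` D \<subseteq> {-1, 1}"
          using configurationD(3)[OF config] by blast
        show "\<exists>a. (a, b) \<in> G'" for b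
          using configurationD(4)[OF config, of b] unfolding G'_def by blast
        have "S a * A a j \<noteq> S i * A i j" if "(a, j) \<in> G" for a
          using that False unfolding col_signs_def by force
        then show "a = a'" if "(a, b) \<in> G'" "(a', b) \<in> G'" "S a * A a b = S a' * A a' b" for a a' b
          using that configurationD(5)[OF config] unfolding G'_def by (metis Pair_inject insertE)
      qed
      ultimately have "config_vector S D G' \<in> covectors CARD('r) chi"
        using less.prems(2) by (intro IH) auto
      \<comment> \<open>The vector changes only at column \<open>j\<close>, which is outside
        \<open>L\<close>, so it still agrees with the old one on the chosen part.\<close>
      moreover have "config_vector S D G' y = (if y = Inr j then 0 else config_vector S D G y)" for y
        using signs by (cases y) auto
      ultimately show ?thesis
        using ij(2) by (intro bexI[of _ "config_vector S D G'"]) (auto simp del: config_vector_simps)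
    qed
  qed
qed

section \<open>Connected configurations are cocircuits\<close>

text \<open>Connectivity is phrased as the absence of a split, so that its failure supplies the
  \<open>K\<close> and \<open>L\<close> of \<open>push_up\<close>.\<close>

definition connected_rows :: "'r set \<Rightarrow> ('r \<times> 'e) set \<Rightarrow> bool" where
  "connected_rows D G \<longleftrightarrow>
     (\<forall>K L. K \<subseteq> D \<longrightarrow> (\<forall>i j. (i, j) \<in> G \<longrightarrow> (i \<in> K \<longleftrightarrow> j \<in> L)) \<longrightarrow> K = {} \<or> K = D)"

lemma opposite_entries:
  assumes "configuration S D G" "(i, j) \<in> G" "(i', j) \<in> G" "i \<noteq> i'"
  shows "S i * A i j = - (S i' * A i' j)"
proof -
  have "x = - y" if "x \<in> {-1, 1}" "y \<in> {-1, 1}" "x \<noteq> y" for x y :: int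
    using that by auto
  then show ?thesis
    using configuration_entry_sign[OF assms(1,2)] configuration_entry_sign[OF assms(1,3)]
      configurationD(5)[OF assms(1-3)] assms(4) by blast
qed

text \<open>Three pairwise opposite numbers would all be zero.\<close>

lemma column_neighbours:
  assumes "configuration S D G" "(i, j) \<in> G" "(i', j) \<in> G" "i \<noteq> i'" "(a, j) \<in> G"
  shows "a = i \<or> a = i'"
proof (rule ccontr)
  assume "\<not> (a = i \<or> a = i')"
  then have "i \<noteq> a" "i' \<noteq> a" by auto
  then have "S i * A i j = 0"
    using opposite_entries[OF assms(1,2,3,4)] opposite_entries[OF assms(1,2,5)]
      opposite_entries[OF assms(1,3,5)] by linarith
  then show False
    using configuration_entry_sign[OF assms(1,2)] by (simp only:) simp
qed

lemma shared_column_conflict: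
  assumes "configuration S D G" "(i, j) \<in> G" "(i', j) \<in> G" "i \<noteq> i'"
  shows "j \<in> conflicts S G"
proof (rule ccontr)
  assume "j \<notin> conflicts S G"
  then have "S i * A i j = S i' * A i' j"
    using entry_eq_if_nonconflict[OF assms(1)] assms(2,3) by (metis singleton_inject)
  then show False
    using configurationD(5)[OF assms(1-3)] assms(4) by blast
qed

text \<open>Viewed as edges between their two neighbours, the conflict columns form a tree on
  \<open>D\<close>. Rooted at \<open>r\<close>, each other row is assigned the edge towards the
  root; the proof grows this tree row by row.\<close>

lemma connected_configuration_spanning:
  assumes config: "configuration S D G"
    and connected: "connected_rows D G"
    and "r \<in> D"
  obtains f where "inj_on f (D - {r})" "f ` (D - {r}) = conflicts S G" "\<And>i. i \<in> D - {r} \<Longrightarrow> (i, f i) \<in> G"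
proof -
  define spans where "spans W f \<longleftrightarrow> r \<in> W \<and> W \<subseteq> D \<and> inj_on f (W - {r}) \<and>
    (\<forall>w\<in>W - {r}. f w \<in> conflicts S G \<and> (w, f w) \<in> G \<and> (\<forall>i. (i, f w) \<in> G \<longrightarrow> i \<in> W)) \<and>
    (\<forall>U. (\<forall>w\<in>W - {r}. \<forall>i i'. (i, f w) \<in> G \<longrightarrow> (i', f w) \<in> G \<longrightarrow> (i \<in> U \<longleftrightarrow> i' \<in> U)) \<longrightarrow>
       (\<forall>w\<in>W. w \<in> U \<longleftrightarrow> r \<in> U))" for W and f :: "'r \<Rightarrow> 'e"
  txt \<open>The last conjunct of \<open>spans\<close> says that the columns matched so far connect \<open>W\<close>.\<close>
  have spansD: "r \<in> W" "W \<subseteq> D" "inj_on f (W - {r})"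
    "\<forall>w\<in>W - {r}. f w \<in> conflicts S G \<and> (w, f w) \<in> G \<and> (\<forall>i. (i, f w) \<in> G \<longrightarrow> i \<in> W)"
    "\<forall>U. (\<forall>w\<in>W - {r}. \<forall>i i'. (i, f w) \<in> G \<longrightarrow> (i', f w) \<in> G \<longrightarrow> (i \<in> U \<longleftrightarrow> i' \<in> U)) \<longrightarrow>
       (\<forall>w\<in>W. w \<in> U \<longleftrightarrow> r \<in> U)" if "spans W f" for W f
    by (rule that[unfolded spans_def, THEN conjunct1]
        that[unfolded spans_def, THEN conjunct2, THEN conjunct1]
        that[unfolded spans_def, THEN conjunct2, THEN conjunct2, THEN conjunct1]
        that[unfolded spans_def, THEN conjunct2, THEN conjunct2, THEN conjunct2, THEN conjunct1]
        that[unfolded spans_def, THEN conjunct2, THEN conjunct2, THEN conjunct2, THEN conjunct2])+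
  have "\<exists>W f. card W = Suc k \<and> spans W f" if "Suc k \<le> card D" for k
    using that
  proof (induction k)
    case 0
    show ?case
      by (rule exI[of _ "{r}"]) (simp add: spans_def \<open>r \<in> D\<close>)
  next
    case (Suc k)
    then obtain W f where W: "card W = Suc k" and "spans W f"
      by auto
    have "r \<in> W" "W \<subseteq> D" "inj_on f (W - {r})"
      using spansD(1-3)[OF \<open>spans W f\<close>] .
    note f_edge = spansD(4)[OF \<open>spans W f\<close>] and f_cut = spansD(5)[OF \<open>spans W f\<close>]
    have "W \<noteq> D" using W Suc.prems by auto
    \<comment> \<open>Otherwise \<open>W\<close> and its neighbouring columns would be a
      split.\<close>
    have "\<exists>i j. (i, j) \<in> G \<and> i \<notin> W \<and> (\<exists>i'\<in>W. (i', j) \<in> G)"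
    proof (rule ccontr)
      assume none: "\<nexists>i j. (i, j) \<in> G \<and> i \<notin> W \<and> (\<exists>i'\<in>W. (i', j) \<in> G)"
      have "W = {} \<or> W = D"
        by (rule connected[unfolded connected_rows_def, rule_format, of W "{j. \<exists>i\<in>W. (i, j) \<in> G}"])
          (use \<open>W \<subseteq> D\<close> none in auto)
      then show False
        using \<open>r \<in> W\<close> \<open>W \<noteq> D\<close> by blast
    qed
    then obtain i j i' where ij: "(i, j) \<in> G" and i': "i \<notin> W" "i' \<in> W" "(i', j) \<in> G"
      by blast
    then have "i \<noteq> i'" by blast
    have nbr: "a = i \<or> a = i'" if "(a, j) \<in> G" for a
      using column_neighbours[OF config ij i'(3) \<open>i \<noteq> i'\<close> that] .
    \<comment> \<open>Columns already used have all their neighbours in \<open>W\<close>, but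
      \<open>i\<close> is a neighbour of \<open>j\<close> outside \<open>W\<close>.\<close>
    have fj: "f w \<noteq> j" if "w \<in> W - {r}" for w
      using f_edge that ij i'(1) by blast
    define f' where "f' = f(i := j)"
    have f': "f' i = j" "\<And>w. w \<in> W \<Longrightarrow> f' w = f w"
      using i'(1) by (auto simp: f'_def)
    have "spans (insert i W) f'"
      unfolding spans_def
    proof (intro conjI ballI allI impI)
      show "r \<in> insert i W" "insert i W \<subseteq> D"
        using \<open>r \<in> W\<close> \<open>W \<subseteq> D\<close> configurationD(2)[OF config ij] by auto
      have "insert i W - {r} = insert i (W - {r})"
        using \<open>r \<in> W\<close> i'(1) by auto
      moreover have "inj_on f' (W - {r})"
        using \<open>inj_on f (W - {r})\<close> by (rule inj_on_cong[THEN iffD1, rotated]) (simp add: f'(2))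
      moreover have "f' i \<notin> f' ` (W - {r})"
        using fj f' by force
      ultimately show "inj_on f' (insert i W - {r})"
        by (simp only: inj_on_insert) blast
    next
      fix w assume w: "w \<in> insert i W - {r}"
      show "f' w \<in> conflicts S G"
        using w f_edge f' shared_column_conflict[OF config ij i'(3) \<open>i \<noteq> i'\<close>]
        by (metis DiffD1 DiffD2 DiffI insertE)
      show "(w, f' w) \<in> G"
        using w f_edge f' ij by (metis DiffD1 DiffD2 DiffI insertE)
      show "a \<in> insert i W" if "(a, f' w) \<in> G" for a
      proof (cases "w = i")
        case True
        then show ?thesis using that f'(1) nbr i'(2) by blast
      next
        case False
        with w have "w \<in> W - {r}" by blast
        moreover from this have "(a, f w) \<in> G" using that f'(2)[of w] by simp
        ultimately show ?thesis using f_edge by blast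
      qed
    next
      fix U w
      assume U: "\<forall>w\<in>insert i W - {r}. \<forall>a b. (a, f' w) \<in> G \<longrightarrow> (b, f' w) \<in> G \<longrightarrow> (a \<in> U \<longleftrightarrow> b \<in> U)"
        and w: "w \<in> insert i W"
      have "\<forall>w\<in>W. w \<in> U \<longleftrightarrow> r \<in> U"
      proof (rule f_cut[THEN spec, THEN mp], intro ballI)
        fix w assume "w \<in> W - {r}"
        then have w: "f' w = f w" "w \<in> insert i W - {r}"
          using f'(2) by auto
        show "\<forall>a b. (a, f w) \<in> G \<longrightarrow> (b, f w) \<in> G \<longrightarrow> (a \<in> U \<longleftrightarrow> b \<in> U)"
          by (rule U[THEN bspec, OF w(2), unfolded w(1)])
      qed
      moreover have "i \<in> insert i W - {r}"
        using \<open>r \<in> W\<close> i'(1) by auto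
      then have "i \<in> U \<longleftrightarrow> i' \<in> U"
        using U i'(3) ij f'(1) by blast
      ultimately show "w \<in> U \<longleftrightarrow> r \<in> U"
        using w i'(2) by blast
    qed
    moreover have "card (insert i W) = Suc (Suc k)"
      using W i'(1) by simp
    ultimately show ?case by blast
  qed
  moreover have "Suc (card D - 1) = card D"
    using \<open>r \<in> D\<close> by (metis Suc_diff_1 card_gt_0_iff empty_iff finite)
  ultimately obtain W f where W: "card W = card D" and spans: "spans W f"
    by (metis le_refl)
  have "W = D"
    using spans W by (intro card_subset_eq) (simp_all add: spans_def)
  with spans have "spans D f" by simp
  note inj = spansD(3)[OF this] and f_edge = spansD(4)[OF this] and f_cut = spansD(5)[OF this]
  have "j \<in> f ` (D - {r})" if "j \<in> conflicts S G" for j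
  proof (rule ccontr)
    assume j: "j \<notin> f ` (D - {r})"
    have "1 \<in> col_signs S G j" "-1 \<in> col_signs S G j"
      using that unfolding conflicts_def by auto
    then obtain i i' where i: "(i, j) \<in> G" "S i * A i j = 1" and i': "(i', j) \<in> G" "S i' * A i' j = -1"
      unfolding col_signs_def by force
    obtain P where P: "P \<in> \<T>" "G \<subseteq> tree_of P"
      using configurationD(1)[OF config] by blast
    then obtain U V where UV: "i \<in> U" "j \<notin> V"
      "\<And>a b. (a, b) \<in> tree_of P \<Longrightarrow> (a, b) \<noteq> (i, j) \<Longrightarrow> a \<in> U \<longleftrightarrow> b \<in> V"
      using tree_cut[of P i j] i(1) by blast
    have "\<forall>w\<in>D. w \<in> U \<longleftrightarrow> r \<in> U"
    proof (rule f_cut[THEN spec, THEN mp], intro ballI allI impI)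
      fix w a b assume "w \<in> D - {r}" "(a, f w) \<in> G" "(b, f w) \<in> G"
      then show "a \<in> U \<longleftrightarrow> b \<in> U"
        using UV(3)[of a "f w"] UV(3)[of b "f w"] P(2) j by blast
    qed
    moreover have "i' \<noteq> i"
      using i(2) i'(2) by auto
    then have "i' \<notin> U"
      using UV(2) UV(3)[of i' j] i'(1) P(2) by blast
    moreover have "i \<in> D" "i' \<in> D"
      using configurationD(2)[OF config] i(1) i'(1) by blast+
    ultimately show False
      using UV(1) by blast
  qed
  then have "f ` (D - {r}) = conflicts S G"
    using f_edge by blast
  then show ?thesis
    using that inj f_edge by blast
qed

section \<open>Cofactors and the expansion of the chirotope\<close>

lemma extend_matrix_edge:
  assumes "(i, c) \<in> extend_tree G"
  shows "extend_matrix A i c \<in> {-1, 1}"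
  using assms A_sign[of i] by (cases c) (simp_all add: extend_tree_def)

text \<open>
  \<open>cofactor xs G r v\<close> says that \<open>G\<close>, with all pendant edges added, contains a perfect matching of the
  rows other than \<open>r\<close> with the entries of \<open>xs\<close> whose contribution to the chirotope is \<open>v\<close>. The row
  \<open>r\<close> gets index \<open>0\<close>, the place of an element prepended to \<open>xs\<close>.
\<close>

definition cofactor :: "('r + 'e) list \<Rightarrow> ('r \<times> 'e) set \<Rightarrow> 'r \<Rightarrow> int \<Rightarrow> bool" where
  "cofactor xs G r v \<longleftrightarrow> (\<exists>n. bij_betw n UNIV {..<CARD('r)} \<and> n r = 0 \<and>
     (\<forall>i\<in>-{r}. (i, xs ! (n i - 1)) \<in> extend_tree G) \<and>
     v = sign (index_perm n) * (\<Prod>i\<in>-{r}. extend_matrix A i (xs ! (n i - 1))))"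

lemma cofactor_sign: "cofactor xs G r v \<Longrightarrow> v \<in> {-1, 1}"
proof -
  assume "cofactor xs G r v"
  then obtain n where n: "\<forall>i\<in>-{r}. (i, xs ! (n i - 1)) \<in> extend_tree G"
    "v = sign (index_perm n) * (\<Prod>i\<in>-{r}. extend_matrix A i (xs ! (n i - 1)))"
    unfolding cofactor_def by blast
  have "\<bar>\<Prod>i\<in>-{r}. extend_matrix A i (xs ! (n i - 1))\<bar> = 1"
    unfolding abs_prod using n(1) extend_matrix_edge by (intro prod.neutral) fastforce
  then have "\<bar>v\<bar> = 1"
    unfolding n(2) by (simp add: abs_mult sign_def)
  then show ?thesis by auto
qed

text \<open>Row \<open>r\<close> is unmatched, so the partner of \<open>j\<close> must be
  \<open>r'\<close>. Handing \<open>j\<close> over to \<open>r\<close> is a transposition, which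
  gives the minus sign, and replaces the factor \<open>A r' j\<close> by
  \<open>A r j\<close>.\<close>

lemma cofactor_swap:
  assumes "cofactor xs G r v" "r \<noteq> r'" "(r, j) \<in> G" "(r', j) \<in> G"
    and nbr: "\<And>i. (i, j) \<in> G \<Longrightarrow> i = r \<or> i = r'"
    and len: "Suc (length xs) = CARD('r)" and j: "Inr j \<in> set xs"
  shows "cofactor xs G r' (- v * A r j * A r' j)"
proof -
  obtain n where n: "bij_betw n UNIV {..<CARD('r)}" "n r = 0"
    "\<And>i. i \<noteq> r \<Longrightarrow> (i, xs ! (n i - 1)) \<in> extend_tree G"
    "v = sign (index_perm n) * (\<Prod>i\<in>-{r}. extend_matrix A i (xs ! (n i - 1)))"
    using assms(1) unfolding cofactor_def by blast
  obtain k where k: "k < length xs" "xs ! k = Inr j"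
    using j by (auto simp: in_set_conv_nth)
  then have "Suc k \<in> n ` UNIV"
    using n(1) len unfolding bij_betw_def by auto
  then obtain a where a: "n a = Suc k" by auto
  with n(2) have "a \<noteq> r" by auto
  with n(3)[of a] a k have "(a, j) \<in> G"
    by (auto simp: extend_tree_def)
  with nbr \<open>a \<noteq> r\<close> have "a = r'" by blast
  with a k have r': "n r' = Suc k" "xs ! (n r' - 1) = Inr j" by simp_all
  define n' where "n' = n \<circ> Transposition.transpose r r'"
  have n'_simps: "n' r = n r'" "n' r' = n r" "\<And>i. i \<noteq> r \<Longrightarrow> i \<noteq> r' \<Longrightarrow> n' i = n i"
    by (auto simp: n'_def)
  have split: "-{r} = insert r' (-{r, r'})" "-{r'} = insert r (-{r, r'})"
    using \<open>r \<noteq> r'\<close> by auto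
  let ?p = "\<Prod>i\<in>-{r, r'}. extend_matrix A i (xs ! (n i - 1))"
  have "v = sign (index_perm n) * (A r' j * ?p)"
    unfolding n(4) split(1) using r' by simp
  moreover have "(\<Prod>i\<in>-{r'}. extend_matrix A i (xs ! (n' i - 1))) = A r j * ?p"
  proof -
    have "(\<Prod>i\<in>-{r, r'}. extend_matrix A i (xs ! (n' i - 1))) = ?p"
      by (rule prod.cong) (auto simp: n'_simps(3))
    then show ?thesis
      unfolding split(2) using r' n'_simps(1) by simp
  qed
  moreover have "A r' j * A r' j = 1"
    using A_sign[of r' j] by auto
  moreover have "sign (index_perm n') = - sign (index_perm n)"
    unfolding n'_def using n(1) assms(2) by (rule sign_index_perm_swap)
  ultimately have v: "- v * A r j * A r' j =
      sign (index_perm n') * (\<Prod>i\<in>-{r'}. extend_matrix A i (xs ! (n' i - 1)))"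
    by (simp add: mult.assoc mult.left_commute)
  have "bij_betw n' UNIV {..<CARD('r)}"
    unfolding n'_def using bij_transpose n(1) by (rule bij_betw_trans)
  moreover have "(i, xs ! (n' i - 1)) \<in> extend_tree G" if "i \<noteq> r'" for i
    using that n(3) n'_simps r' assms(3) by (cases "i = r") (auto simp: extend_tree_def)
  ultimately show ?thesis
    unfolding cofactor_def using v n(2) n'_simps(2) by (intro exI[of _ n']) auto
qed

text \<open>Matching \<open>y\<close> with \<open>r\<close> completes the cofactor to a perfect
  matching inside one tree, which by uniqueness is the one in the matching field. The expansion
  along \<open>y\<close> therefore has a single term.\<close>

lemma alternating_ext_cofactor:
  assumes "P \<in> \<T>" "G \<subseteq> tree_of P" "distinct (y # xs)" "Suc (length xs) = CARD('r)"
    and "(r, y) \<in> extend_tree G" "cofactor xs G r v"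
  shows "alternating_ext chi (y # xs) = v * extend_matrix A r y"
proof -
  obtain n where n: "bij_betw n UNIV {..<CARD('r)}" "n r = 0"
    "\<And>i. i \<noteq> r \<Longrightarrow> (i, xs ! (n i - 1)) \<in> extend_tree G"
    "v = sign (index_perm n) * (\<Prod>i\<in>-{r}. extend_matrix A i (xs ! (n i - 1)))"
    using assms(6) unfolding cofactor_def by blast
  have nth: "(y # xs) ! n i = (if i = r then y else xs ! (n i - 1))" for i
  proof (cases "i = r")
    case False
    then have "n i \<noteq> 0"
      using n(1,2) unfolding bij_betw_def inj_on_def by (metis UNIV_I)
    with False show ?thesis by (simp add: nth_Cons')
  qed (simp add: n(2))
  let ?M = "{(i, (y # xs) ! n i) | i. True}"
  have "matching_field (extended_trees \<T>) (set (y # xs)) = ?M"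
  proof (rule matching_field_eqI[OF assms(1)])
    have "?M \<subseteq> extend_tree G"
      using n(3) assms(5) by (auto simp: nth)
    also have "\<dots> \<subseteq> extend_tree (tree_of P)"
      using assms(2) by (auto simp: extend_tree_def)
    finally show "?M \<subseteq> extend_tree (tree_of P)" .
    show "perfect_matching (set (y # xs)) ?M"
      by (rule perfect_matching_tuple) (use assms n(1) in auto)
  qed
  then have "alternating_ext chi (y # xs) =
      sign (index_perm n) * (\<Prod>i\<in>UNIV. extend_matrix A i ((y # xs) ! n i))"
    using assms n(1) by (intro alternating_ext_matching_chirotope) auto
  also have "(UNIV :: 'r set) = insert r (-{r})" by auto
  also have "(\<Prod>i\<in>insert r (-{r}). extend_matrix A i ((y # xs) ! n i)) =
      extend_matrix A r y * (\<Prod>i\<in>-{r}. extend_matrix A i (xs ! (n i - 1)))"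
    unfolding nth by (subst prod.insert) (auto intro!: prod.cong)
  finally show ?thesis
    by (simp add: n(4))
qed

text \<open>The spanning assignment yields a cofactor at \<open>r\<close>. Swapping along conflict
  columns carries it to every row of \<open>D\<close>, with values proportional to
  \<open>S\<close>.\<close>

lemma connected_configuration_cocircuit:
  assumes config: "configuration S D G"
    and connected: "connected_rows D G"
  shows "config_vector S D G \<in> cocircuits CARD('r) chi"
proof -
  obtain r where "r \<in> D"
    using configurationD(2,4)[OF config] by blast
  obtain P where P: "P \<in> \<T>" "G \<subseteq> tree_of P"
    using configurationD(1)[OF config] by blast
  obtain f where f: "inj_on f (D - {r})" "f ` (D - {r}) = conflicts S G"
    "\<And>i. i \<in> D - {r} \<Longrightarrow> (i, f i) \<in> G"
    using connected_configuration_spanning[OF config connected \<open>r \<in> D\<close>] by blast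
  \<comment> \<open>Rows of \<open>D\<close> other than \<open>r\<close> are matched along the
    spanning assignment, rows outside \<open>D\<close> with their own copies;
    \<open>extend_tree G\<close> has these pendant edges even though they are absent from the
    configuration.\<close>
  define m where "m i = (if i \<in> D then Inr (f i) else Inl i)" for i
  define \<tau> where "\<tau> = m ` (-{r})"
  have "m ` (D - {r}) = Inr ` conflicts S G" "m ` (-D) = Inl ` (-D)"
    unfolding f(2)[symmetric] image_image by (rule image_cong; simp add: m_def)+
  moreover have "-{r} = (D - {r}) \<union> -D"
    using \<open>r \<in> D\<close> by auto
  ultimately have \<tau>: "\<tau> = Inr ` conflicts S G \<union> Inl ` (-D)"
    by (simp only: \<tau>_def image_Un)
  have inj_m: "inj_on m (-{r})"
    using f(1) by (auto simp: inj_on_def m_def)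
  obtain xs where xs: "set xs = \<tau>" "distinct xs"
    using finite_distinct_list[of \<tau>] \<tau>_def by auto
  have len: "Suc (length xs) = CARD('r)"
    using distinct_card[OF xs(2)] card_image[OF inj_m] xs(1) \<open>r \<in> D\<close>
    by (simp add: \<tau>_def Compl_eq_Diff_UNIV)
  have "\<exists>k<length xs. xs ! k = m i" if "i \<noteq> r" for i
    using that xs(1) unfolding \<tau>_def by (auto simp flip: in_set_conv_nth)
  then obtain k where k: "\<And>i. i \<noteq> r \<Longrightarrow> k i < length xs" "\<And>i. i \<noteq> r \<Longrightarrow> xs ! k i = m i"
    by metis
  define n where "n i = (if i = r then 0 else Suc (k i))" for i
  have "inj n"
    using k(2) inj_m unfolding inj_on_def n_def by (metis ComplI Suc_inject nat.distinct(1) singletonD)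
  moreover have "range n \<subseteq> {..<CARD('r)}"
    using k(1) len by (force simp: n_def)
  then have "range n = {..<CARD('r)}"
    using \<open>inj n\<close> by (intro card_subset_eq) (simp_all add: card_image)
  ultimately have n: "bij_betw n UNIV {..<CARD('r)}"
    by (simp add: bij_betw_def)
  have "\<forall>i\<in>-{r}. (i, xs ! (n i - 1)) \<in> extend_tree G"
    using k(2) f(3) by (auto simp: n_def m_def extend_tree_def)
  then have "\<exists>v. cofactor xs G r v"
    unfolding cofactor_def using n by (intro exI conjI) (assumption | simp add: n_def)+
  then obtain v where v: "cofactor xs G r v" ..
  define c where "c = v * S r"
  have S: "S i * S i = 1" if "i \<in> D" for i
    using configurationD(3)[OF config that] by auto
  have c: "c * c = 1" "c \<in> {-1, 1}" "v = c * S r"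
    using cofactor_sign[OF v] configurationD(3)[OF config \<open>r \<in> D\<close>] by (auto simp: c_def)
  \<comment> \<open>\<open>K\<close> collects the rows reached with the expected value; it is closed
    under sharing a column, so connectivity makes it all of \<open>D\<close>.\<close>
  define K where "K = {i \<in> D. cofactor xs G i (c * S i)}"
  have "K = {} \<or> K = D"
  proof (rule connected[unfolded connected_rows_def, rule_format])
    show "K \<subseteq> D" by (auto simp: K_def)
    fix i j assume ij: "(i, j) \<in> G"
    have "i \<in> K" if "i' \<in> K" "(i', j) \<in> G" for i'
    proof (cases "i = i'")
      case False
      then have "Inr j \<in> set xs"
        using shared_column_conflict[OF config ij that(2)] xs(1) \<tau> by auto
      have "cofactor xs G i (- (c * S i') * A i' j * A i j)"
      proof (rule cofactor_swap)
        show "a = i' \<or> a = i" if "(a, j) \<in> G" for a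
          using column_neighbours[OF config ij \<open>(i', j) \<in> G\<close> False that] by blast
      qed (use that ij False len \<open>Inr j \<in> set xs\<close> in \<open>auto simp: K_def\<close>)
      \<comment> \<open>The sign of the swap cancels against the opposite signs of the two entries
        in column \<open>j\<close>.\<close>
      moreover have "- (c * S i') * A i' j * A i j = c * S i"
      proof -
        have "A i j * A i j = 1"
          using A_sign[of i j] by auto
        then have "c * S i = c * (S i * A i j) * A i j"
          by (simp add: mult.assoc)
        then show ?thesis
          using opposite_entries[OF config ij that(2) False] by (simp add: mult.assoc)
      qed
      ultimately show ?thesis
        using configurationD(2)[OF config ij] by (simp add: K_def)
    qed (use that in simp)
    then show "i \<in> K \<longleftrightarrow> j \<in> {j. \<exists>i'\<in>K. (i', j) \<in> G}"
      using ij by blast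
  qed
  moreover have "r \<in> K"
    using v c(3) \<open>r \<in> D\<close> by (simp add: K_def)
  ultimately have cof: "cofactor xs G i (c * S i)" if "i \<in> D" for i
    using that by (auto simp: K_def)
  have "config_vector S D G y = c * alternating_ext chi (y # xs)" for y
  proof (cases "y \<in> \<tau>")
    case True
    then have "config_vector S D G y = 0"
      unfolding \<tau> by (auto simp: conflicts_def)
    with True show ?thesis
      by (simp add: alternating_ext_def xs(1))
  next
    case False
    \<comment> \<open>Off the zero set, one edge at \<open>y\<close> already carries the sign of the
      vector.\<close>
    have "\<exists>i\<in>D. (i, y) \<in> extend_tree G \<and> config_vector S D G y = S i * extend_matrix A i y"
    proof (cases y)
      case (Inl i)
      with False show ?thesis
        unfolding \<tau> by (intro bexI[of _ i]) (auto simp: extend_tree_def)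
    next
      case (Inr j)
      obtain i where i: "(i, j) \<in> G"
        using configurationD(4)[OF config] by blast
      have "j \<notin> conflicts S G"
        using False Inr unfolding \<tau> by auto
      then show ?thesis
        using entry_eq_if_nonconflict[OF config i] configurationD(2)[OF config i] i Inr
        by (intro bexI[of _ i]) (auto simp: extend_tree_def)
    qed
    then obtain i where i: "i \<in> D" "(i, y) \<in> extend_tree G" "config_vector S D G y = S i * extend_matrix A i y"
      by blast
    have "alternating_ext chi (y # xs) = c * S i * extend_matrix A i y"
      using P xs False len i(2) cof[OF i(1)] by (intro alternating_ext_cofactor) auto
    then show ?thesis
      unfolding i(3) using c(1) by (simp flip: mult.assoc)
  qed
  then have "config_vector S D G = (\<lambda>y. c * alternating_ext chi (y # xs))"
    by (rule ext)
  moreover have "config_vector S D G \<noteq> (\<lambda>_. 0)"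
  proof
    assume "config_vector S D G = (\<lambda>_. 0)"
    then have "config_vector S D G (Inl r) = 0" by (rule fun_cong)
    then show False
      using S[OF \<open>r \<in> D\<close>] \<open>r \<in> D\<close> by simp
  qed
  ultimately show ?thesis
    unfolding cocircuits_def mem_Collect_eq using len c(2) by (intro conjI exI[of _ xs] bexI[of _ c])
qed

section \<open>Configurations are covectors\<close>

lemma configuration_covector:
  assumes "configuration S D G"
  shows "config_vector S D G \<in> covectors CARD('r) chi"
  using assms
proof (induction "card D + card (- conflicts S G)" arbitrary: D G rule: less_induct)
  case less
  note config = less.prems
  show ?case
  proof (cases "\<exists>K L. K \<subseteq> D \<and> (\<forall>i j. (i, j) \<in> G \<longrightarrow> (i \<in> K \<longleftrightarrow> j \<in> L)) \<and> K \<noteq> {} \<and> K \<noteq> D")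
    case False
    then have "config_vector S D G \<in> cocircuits CARD('r) chi"
      by (intro connected_configuration_cocircuit config) (unfold connected_rows_def, blast)
    then show ?thesis
      by (rule cocircuit_imp_covector)
  next
    case True
    then obtain K L where K: "K \<subseteq> D" "K \<noteq> {}" "K \<noteq> D" and closed: "\<And>i j. (i, j) \<in> G \<Longrightarrow> i \<in> K \<longleftrightarrow> j \<in> L"
      by blast
    have "\<exists>X\<in>covectors CARD('r) chi. (\<forall>y. X y \<in> {0, config_vector S D G y}) \<and>
      (\<forall>i\<in>K. X (Inl i) = config_vector S D G (Inl i)) \<and>
      (\<forall>j\<in>L. X (Inr j) = config_vector S D G (Inr j))"
      by (rule push_up[OF less.hyps config refl K closed])
    then obtain X where X: "X \<in> covectors CARD('r) chi" "\<And>y. X y \<in> {0, config_vector S D G y}"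
      "\<And>i. i \<in> K \<Longrightarrow> X (Inl i) = config_vector S D G (Inl i)"
      "\<And>j. j \<in> L \<Longrightarrow> X (Inr j) = config_vector S D G (Inr j)"
      by blast
    \<comment> \<open>The complementary pair \<open>D - K\<close>, \<open>-L\<close> is also a
      split.\<close>
    have "\<exists>Y\<in>covectors CARD('r) chi. (\<forall>y. Y y \<in> {0, config_vector S D G y}) \<and>
      (\<forall>i\<in>D - K. Y (Inl i) = config_vector S D G (Inl i)) \<and>
      (\<forall>j\<in>-L. Y (Inr j) = config_vector S D G (Inr j))"
      by (rule push_up[OF less.hyps config refl])
        (use K closed configurationD(2)[OF config] in blast)+
    then obtain Y where Y: "Y \<in> covectors CARD('r) chi" "\<And>y. Y y \<in> {0, config_vector S D G y}"
      "\<And>i. i \<in> D - K \<Longrightarrow> Y (Inl i) = config_vector S D G (Inl i)"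
      "\<And>j. j \<in> -L \<Longrightarrow> Y (Inr j) = config_vector S D G (Inr j)"
      by blast
    have "sign_compose X Y = config_vector S D G"
    proof
      fix y
      \<comment> \<open>The two parts cover all columns and all copies of rows in \<open>D\<close>;
        at the other copies the vector is zero.\<close>
      have "X y = config_vector S D G y \<or> Y y = config_vector S D G y \<or> config_vector S D G y = 0"
        using X(3,4) Y(3,4) by (cases y) (metis Compl_iff Diff_iff config_vector_simps(1))+
      then show "sign_compose X Y y = config_vector S D G y"
        using X(2)[of y] Y(2)[of y] unfolding sign_compose_def by auto
    qed
    then show ?thesis
      using sign_compose_covectors[OF X(1) Y(1)] by simp
  qed
qed

end

section \<open>Reduction of psi to configurations\<close>

lemma sum_signs:
  assumes "X \<subseteq> {-1, 0, 1 :: int}"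
  shows "\<Sum>X = of_bool (1 \<in> X) - of_bool (-1 \<in> X)"
proof -
  have "\<Sum>X = (\<Sum>x\<in>{-1, 0, 1}. if x \<in> X then x else 0)"
    using assms by (simp add: sum.inter_restrict[symmetric] Int_absorb1)
  then show ?thesis by simp
qed

text \<open>The difference of indicators treats all cases of \<open>psi\<close> at once: both signs
  cancel and no sign gives zero.\<close>

lemma psi_eq_signs:
  assumes "\<And>i. restricted_matrix A S F i j \<in> {-1, 0, 1}"
  shows "psi A S F j = of_bool (\<exists>i. restricted_matrix A S F i j = 1) - of_bool (\<exists>i. restricted_matrix A S F i j = -1)"
proof -
  have "restricted_matrix A S F i j > 0 \<longleftrightarrow> restricted_matrix A S F i j = 1"
    "restricted_matrix A S F i j < 0 \<longleftrightarrow> restricted_matrix A S F i j = -1"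
    "restricted_matrix A S F i j \<ge> 0 \<longleftrightarrow> restricted_matrix A S F i j \<noteq> -1"
    "restricted_matrix A S F i j = 0 \<longleftrightarrow> restricted_matrix A S F i j \<noteq> 1 \<and> restricted_matrix A S F i j \<noteq> -1" for i
    using assms[of i] by auto
  note eqs = this
  show ?thesis
    unfolding psi_def Let_def eqs(1-3) eqs(4) by auto
qed

theorem proposition3p32:
  fixes \<T> :: "((real ^ 'r::{finite,linorder}) \<times> (real ^ 'e::{finite,linorder})) set set"
    and A :: "'r \<Rightarrow> 'e \<Rightarrow> int"
    and t F :: "('r \<times> ('r + 'e)) set"
    and S :: "'r \<Rightarrow> int"
  assumes "CARD('r) \<le> CARD('e)"
    and "prod_triangulation \<T>"
    and "\<And>i j. A i j \<in> {-1, 1}"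
    and "t \<in> extended_trees \<T>" and "F \<subseteq> t"
    and "\<And>j. \<not> col_isolated F (Inr j)"
    and "\<And>i. col_isolated F (Inl i) \<Longrightarrow> row_isolated F i"
    and "\<And>i. S i \<in> {-1, 0, 1}"
    and "{i. \<not> row_isolated F i} \<subseteq> {i. S i \<noteq> 0}"
  shows "psi (extend_matrix A) S F
           \<in> covectors CARD('r) (matching_chirotope (extended_trees \<T>) (extend_matrix A))"
proof -
  interpret signed_triangulation \<T> A
    by unfold_locales (use assms(2,3) in auto)
  obtain P where P: "P \<in> \<T>" "F \<subseteq> extend_tree (tree_of P)"
    using assms(4,5) unfolding extended_trees_def by auto
  have Inl: "k = i" if "(i, Inl k) \<in> F" for i k
    using that P(2) unfolding extend_tree_def by auto
  define D where "D = {i. (i, Inl i) \<in> F}"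
  define F0 where "F0 = {(i, j). (i, Inr j) \<in> F}"
  \<comment> \<open>A row whose pendant edge is kept is not isolated, so it lies in the support of
    \<open>S\<close>.\<close>
  have SD: "S i \<in> {-1, 1}" if "i \<in> D" for i
    using that assms(8)[of i] assms(9) unfolding D_def row_isolated_def by blast
  \<comment> \<open>A row with an edge into \<open>'e\<close> is not isolated, so neither is its
    copy, whose only possible edge is the pendant one.\<close>
  have F0: "i \<in> D" if "(i, j) \<in> F0" for i j
    using assms(7)[of i] that Inl unfolding F0_def D_def row_isolated_def col_isolated_def by auto
  have sgn: "S i * A i j \<in> {-1, 1}" if "(i, j) \<in> F0" for i j
    using SD[OF F0[OF that]] assms(3)[of i j] by auto
  \<comment> \<open>\<open>row j s\<close> picks one neighbour of column \<open>j\<close> for each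
    sign present; keeping only these edges preserves every \<open>col_signs\<close> and produces a
    configuration.\<close>
  define row where "row j s = (SOME i. (i, j) \<in> F0 \<and> S i * A i j = s)" for j s
  have row: "(row j s, j) \<in> F0" "S (row j s) * A (row j s) j = s" if "s \<in> col_signs S F0 j" for j s
    using that someI_ex[of "\<lambda>i. (i, j) \<in> F0 \<and> S i * A i j = s"] unfolding col_signs_def row_def by blast+
  define G where "G = {(row j s, j) | j s. s \<in> col_signs S F0 j}"
  have "configuration S D G"
    unfolding configuration_def
  proof (intro conjI allI impI)
    show "\<exists>P\<in>\<T>. G \<subseteq> tree_of P"
      using P row(1) unfolding G_def F0_def extend_tree_def by (intro bexI[of _ P]) auto
    show "fst ` G \<subseteq> D"
      unfolding G_def by (auto intro: F0[OF row(1)])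
    show "S ` D \<subseteq> {-1, 1}"
      using SD by blast
    show "\<exists>i. (i, j) \<in> G" for j
    proof -
      obtain i where "(i, j) \<in> F0"
        using assms(6)[of j] unfolding col_isolated_def F0_def by auto
      then have "S i * A i j \<in> col_signs S F0 j"
        unfolding col_signs_def by blast
      then show ?thesis
        unfolding G_def by blast
    qed
    show "i = i'" if "(i, j) \<in> G" "(i', j) \<in> G" "S i * A i j = S i' * A i' j" for i i' j
      using that row(2) unfolding G_def by auto
  qed
  moreover have "config_vector S D G y = psi (extend_matrix A) S F y" for y
  proof -
    let ?B = "restricted_matrix (extend_matrix A) S F"
    have B: "?B i c \<in> {-1, 0, 1}" for i c
    proof (cases c)
      case (Inl k)
      then show ?thesis using assms(8)[of i] by (auto simp: restricted_matrix_def)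
    next
      case (Inr j)
      then show ?thesis using assms(8)[of i] assms(3)[of i j] by (auto simp: restricted_matrix_def)
    qed
    show ?thesis
    proof (cases y)
      case (Inl k)
      have "?B i (Inl k) = (if i = k \<and> k \<in> D then S k else 0)" for i
        using Inl by (auto simp: restricted_matrix_def D_def)
      then show ?thesis
        using SD[of k] Inl psi_eq_signs[OF B] by auto
    next
      case (Inr j)
      have "s \<in> col_signs S G j \<longleftrightarrow> s \<in> col_signs S F0 j" for s
        using row unfolding G_def by (auto simp: col_signs_def) metis+
      then have "col_signs S G j = col_signs S F0 j" by blast
      moreover have "\<Sum>(col_signs S F0 j) = of_bool (1 \<in> col_signs S F0 j) - of_bool (-1 \<in> col_signs S F0 j)"
        using sgn by (intro sum_signs) (auto simp: col_signs_def)
      moreover have "s \<in> col_signs S F0 j \<longleftrightarrow> (\<exists>i. ?B i (Inr j) = s)" if "s \<noteq> 0" for s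
        using that by (auto simp: col_signs_def restricted_matrix_def F0_def)
      ultimately show ?thesis
        using Inr psi_eq_signs[OF B] by simp
    qed
  qed
  ultimately show ?thesis
    using configuration_covector by (metis ext)
qed

end
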